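(* Let $\mathbf T>0$ and let $k$ be an $r\times r$-matrix valued accelerant on $[-\mathbf T,\mathbf T]$, with possibly a jump discontinuity at the origin. Let $\gamma_\tau(t,s)$ be the corresponding resolvent kernel, i.e. $$\gamma_\tau(t,s)-\int_0^\tau k(t-v)\gamma_\tau(v,s)\,dv=k(t-s),\qquad 0\le t,s\le\tau,\ 0<\tau\le\mathbf T .$$ For $\lambda\in\mathbb C$ and $0\le\tau\le \mathbf T$ put $$\mathcal P(\tau,\lambda)=e^{i\lambda\tau}\Big(I_r+\int_0^\tau e^{-i\lambda x}\gamma_\tau(x,0)\,dx\Big),\qquad \mathcal P_*(\tau,\lambda)=I_r+\int_0^\tau e^{i\lambda x}\gamma_\tau(\tau-x,\tau)\,dx .$$ Then the function $a(\tau)=\gamma_\tau(0,\tau)$, $0<\tau\le\mathbf T$, extends to a continuous function on $[0,\mathbf T]$, and $Y(\tau,\lambda)=\begin{bmatrix}\mathcal P(\tau,\lambda)&\mathcal P_*(\tau,\lambda)\end{bmatrix}$ satisfies, for $\tau\in[0,\mathbf T]$ and every $\lambda\in\mathbb C$, $$\frac{\partial}{\partial\tau}Y(\tau,\lambda)=Y(\tau,\lambda)\left(i\lambda\begin{bmatrix}I_r&0\\ 0&0\end{bmatrix}+\begin{bmatrix}0&a(\tau)\\ a(\tau)^*&0\end{bmatrix}\right).$$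
   Context: An $r\times r$-matrix valued accelerant on $[-\mathbf T,\mathbf T]$, with possibly a jump discontinuity at the origin, is a function $k:[-\mathbf T,\mathbf T]\to\mathbb C^{r\times r}$ which is hermitian, i.e. $k(-t)=k(t)^*$ (for $t\neq0$), is continuous on $[-\mathbf T,0)$ and on $(0,\mathbf T]$ with finite one-sided limits at $0$ (these may differ), and is such that for each $0<\tau\le\mathbf T$ the operator $$(T_\tau f)(t)=f(t)-\int_0^\tau k(t-s)f(s)\,ds,\quad 0\le t\le\tau,$$ is invertible on the space $\mathbf L^1[0,\tau]$ of $\mathbb C^r$-valued integrable functions. The value of $k$ at $0$ is immaterial: it affects $\gamma_\tau(t,s)$ only for $t=s$. At $\tau=0$ the integrals are zero, so $\mathcal P(0,\lambda)=\mathcal P_*(0,\lambda)=I_r$. Derivatives at the endpoints of $[0,\mathbf T]$ are one-sided. $^*$ denotes the adjoint (conjugate transpose). *)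

theory Defs
  imports "HOL-Analysis.Analysis"
begin

definition conj_transpose :: "complex^'n^'m \<Rightarrow> complex^'m^'n" where
  "conj_transpose A = transpose (map_matrix cnj A)"

definition cscale :: "complex \<Rightarrow> complex^'n^'m \<Rightarrow> complex^'n^'m" where
  "cscale c A = map_matrix (\<lambda>z. c * z) A"

definition block_row :: "complex^'n^'m \<Rightarrow> complex^'p^'m \<Rightarrow> complex^('n + 'p)^'m" where
  "block_row A B = (\<chi> i j. case j of Inl j' \<Rightarrow> A $ i $ j' | Inr j' \<Rightarrow> B $ i $ j')"

definition block_mat ::
  "complex^'n^'m \<Rightarrow> complex^'p^'m \<Rightarrow> complex^'n^'q \<Rightarrow> complex^'p^'q \<Rightarrow> complex^('n + 'p)^('m + 'q)"
where
  "block_mat A B C D =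
     (\<chi> i. case i of Inl i' \<Rightarrow> block_row A B $ i' | Inr i' \<Rightarrow> block_row C D $ i')"

text \<open>
  The space of integrable vector functions on \<open>[0,\<tau>]\<close> is handled through representatives:
  elements are functions, equality is equality almost everywhere on \<open>[0,\<tau>]\<close>. For operators,
  linearity up to null sets together with the norm bound implies compatibility with this equality.
\<close>

definition L1 :: "real \<Rightarrow> (real \<Rightarrow> complex^'r) set" where
  "L1 \<tau> = {f. f absolutely_integrable_on {0..\<tau>}}"

definition L1_eq :: "real \<Rightarrow> (real \<Rightarrow> complex^'r) \<Rightarrow> (real \<Rightarrow> complex^'r) \<Rightarrow> bool" where
  "L1_eq \<tau> f g \<longleftrightarrow> (AE t in lebesgue_on {0..\<tau>}. f t = g t)"

definition L1_norm :: "real \<Rightarrow> (real \<Rightarrow> complex^'r) \<Rightarrow> real" where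
  "L1_norm \<tau> f = integral {0..\<tau>} (\<lambda>t. norm (f t))"

definition L1_bounded_operator ::
  "real \<Rightarrow> ((real \<Rightarrow> complex^'r) \<Rightarrow> (real \<Rightarrow> complex^'r)) \<Rightarrow> bool" where
  "L1_bounded_operator \<tau> A \<longleftrightarrow>
     (\<forall>f \<in> L1 \<tau>. A f \<in> L1 \<tau>) \<and>
     (\<forall>f \<in> L1 \<tau>. \<forall>g \<in> L1 \<tau>. L1_eq \<tau> (A (\<lambda>t. f t + g t)) (\<lambda>t. A f t + A g t)) \<and>
     (\<forall>c. \<forall>f \<in> L1 \<tau>. L1_eq \<tau> (A (\<lambda>t. c *s f t)) (\<lambda>t. c *s A f t)) \<and>
     (\<exists>C. \<forall>f \<in> L1 \<tau>. L1_norm \<tau> (A f) \<le> C * L1_norm \<tau> f)"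

definition L1_invertible ::
  "real \<Rightarrow> ((real \<Rightarrow> complex^'r) \<Rightarrow> (real \<Rightarrow> complex^'r)) \<Rightarrow> bool" where
  "L1_invertible \<tau> A \<longleftrightarrow> L1_bounded_operator \<tau> A \<and>
     (\<exists>B. L1_bounded_operator \<tau> B \<and>
        (\<forall>f \<in> L1 \<tau>. L1_eq \<tau> (B (A f)) f \<and> L1_eq \<tau> (A (B f)) f))"

definition conv_operator ::
  "(real \<Rightarrow> complex^'r^'r) \<Rightarrow> real \<Rightarrow> (real \<Rightarrow> complex^'r) \<Rightarrow> real \<Rightarrow> complex^'r" where
  "conv_operator k \<tau> f t = f t - integral {0..\<tau>} (\<lambda>s. k (t - s) *v f s)"

definition accelerant :: "real \<Rightarrow> (real \<Rightarrow> complex^'r^'r) \<Rightarrow> bool" where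
  "accelerant T k \<longleftrightarrow>
     (\<forall>t \<in> {-T..T}. t \<noteq> 0 \<longrightarrow> k (- t) = conj_transpose (k t)) \<and>
     continuous_on {-T..<0} k \<and> continuous_on {0<..T} k \<and>
     (\<exists>l. (k \<longlongrightarrow> l) (at_left 0)) \<and> (\<exists>l. (k \<longlongrightarrow> l) (at_right 0)) \<and>
     (\<forall>\<tau>. 0 < \<tau> \<and> \<tau> \<le> T \<longrightarrow> L1_invertible \<tau> (conv_operator k \<tau>))"

text \<open>
  Integrability of \<open>\<gamma> \<tau> v s\<close> in \<open>v\<close> makes the integral in the resolvent equation
  meaningful, as \<open>integral\<close> is \<open>0\<close> for non-integrable arguments.
  For an accelerant \<open>k\<close> it then determines \<open>\<gamma> \<tau> t s\<close> uniquely for \<open>0 \<le> t, s \<le> \<tau>\<close>.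
\<close>

definition resolvent_kernel ::
  "real \<Rightarrow> (real \<Rightarrow> complex^'r^'r) \<Rightarrow> (real \<Rightarrow> real \<Rightarrow> real \<Rightarrow> complex^'r^'r) \<Rightarrow> bool" where
  "resolvent_kernel T k \<gamma> \<longleftrightarrow>
     (\<forall>\<tau>. 0 < \<tau> \<and> \<tau> \<le> T \<longrightarrow>
        (\<forall>s \<in> {0..\<tau>}. (\<lambda>v. \<gamma> \<tau> v s) absolutely_integrable_on {0..\<tau>}) \<and>
        (\<forall>t \<in> {0..\<tau>}. \<forall>s \<in> {0..\<tau>}.
           \<gamma> \<tau> t s - integral {0..\<tau>} (\<lambda>v. k (t - v) ** \<gamma> \<tau> v s) = k (t - s)))"

definition krein_P ::
  "(real \<Rightarrow> real \<Rightarrow> real \<Rightarrow> complex^'r^'r) \<Rightarrow> real \<Rightarrow> complex \<Rightarrow> complex^'r^'r" where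
  "krein_P \<gamma> \<tau> z =
     cscale (exp (\<i> * z * of_real \<tau>))
       (mat 1 + integral {0..\<tau>} (\<lambda>x. cscale (exp (- \<i> * z * of_real x)) (\<gamma> \<tau> x 0)))"

definition krein_P_star ::
  "(real \<Rightarrow> real \<Rightarrow> real \<Rightarrow> complex^'r^'r) \<Rightarrow> real \<Rightarrow> complex \<Rightarrow> complex^'r^'r" where
  "krein_P_star \<gamma> \<tau> z =
     mat 1 + integral {0..\<tau>} (\<lambda>x. cscale (exp (\<i> * z * of_real x)) (\<gamma> \<tau> (\<tau> - x) \<tau>))"

definition krein_Y ::
  "(real \<Rightarrow> real \<Rightarrow> real \<Rightarrow> complex^'r^'r) \<Rightarrow> real \<Rightarrow> complex \<Rightarrow> complex^('r + 'r)^'r" where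
  "krein_Y \<gamma> \<tau> z = block_row (krein_P \<gamma> \<tau> z) (krein_P_star \<gamma> \<tau> z)"

end

theory Submission imports Defs begin

text \<open>
  Write \<open>X\<^sub>\<tau>(x) = \<gamma>\<^sub>\<tau>(x,0)\<close> and \<open>W\<^sub>\<tau>(x) = \<gamma>\<^sub>\<tau>(x,\<tau>)\<close>, and extend \<open>X\<^sub>\<tau>\<close> to \<open>[0,T]\<close> by its integral equation.
  The difference \<open>D = X\<^sub>\<sigma> - X\<^sub>\<tau>\<close> satisfies
  \<open>D(x) - \<integral>\<^sub>0\<^sup>\<tau> k(x-v) D(v) dv = \<integral>\<^sub>\<tau>\<^sup>\<sigma> k(x-v) X\<^sub>\<sigma>(v) dv\<close>.
  Invertibility of \<open>T\<^sub>\<tau>\<close> for the one fixed \<open>\<tau>\<close> bounds the \<open>L\<^sup>1\<close> norm of \<open>D\<close> by that of the right-hand side,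
  so \<open>\<sigma> \<mapsto> X\<^sub>\<sigma>\<close> is Lipschitz at \<open>\<tau>\<close> uniformly in \<open>x\<close>. The jump of \<open>k\<close> is invisible in \<open>L\<^sup>1\<close>:
  after division by \<open>\<sigma> - \<tau>\<close> the right-hand side tends in \<open>L\<^sup>1\<close> to \<open>k(x-\<tau>) X\<^sub>\<tau>(\<tau>)\<close>, whence
  \<open>\<partial>X\<^sub>\<tau>/\<partial>\<tau> = W\<^sub>\<tau> X\<^sub>\<tau>(\<tau>)\<close> in \<open>L\<^sup>1[0,\<tau>]\<close>; integrating against \<open>e\<^sup>-\<^sup>i\<^sup>\<lambda>\<^sup>x\<close> gives the equation for \<open>P\<close>.
  The reflection \<open>x \<mapsto> \<tau> - x\<close> replaces \<open>k(x)\<close> by \<open>k(-x)\<close> and exchanges the roles of \<open>\<gamma>\<^sub>\<tau>(\<cdot>,0)\<close> and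
  \<open>\<gamma>\<^sub>\<tau>(\<cdot>,\<tau>)\<close>, which gives the equation for \<open>P\<^sub>*\<close>. Finally \<open>\<gamma>\<^sub>\<tau>(0,\<tau>)\<^sup>* = \<gamma>\<^sub>\<tau>(\<tau>,0)\<close> by Fubini, since the
  integral operator is self-adjoint.
\<close>

section \<open>Complex matrices\<close>

lemma bilinear_matrix_mult:
  "bilinear ((**) :: complex^'n^'m \<Rightarrow> complex^'p^'n \<Rightarrow> complex^'p^'m)"
  by (auto simp: bilinear_def linear_iff matrix_matrix_mult_def vec_eq_iff sum.distrib
      algebra_simps scaleR_sum_right)

lemma bounded_bilinear_matrix_mult:
  "bounded_bilinear ((**) :: complex^'n^'m \<Rightarrow> complex^'p^'n \<Rightarrow> complex^'p^'m)"
  using bilinear_matrix_mult bilinear_conv_bounded_bilinear by blast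

interpretation mm: bounded_bilinear
  "(**) :: complex^'n^'m \<Rightarrow> complex^'p^'n \<Rightarrow> complex^'p^'m"
  by (rule bounded_bilinear_matrix_mult)

text \<open>Turns a scalar weight into a left matrix factor, so that the exponential weights become
  instances of the matrix-valued weight \<open>\<phi>\<close> in
  \<open>has_vector_derivative_integral_X\<close>.\<close>

lemma cscale_eq_mult: "cscale c A = cscale c (mat 1) ** A"
  by (simp add: cscale_def map_matrix_def matrix_matrix_mult_def mat_def vec_eq_iff
      if_distrib if_distribR sum.delta cong: if_cong)

lemma cscale_mult_left: "cscale c A ** B = cscale c (A ** B)"
  by (metis cscale_eq_mult matrix_mul_assoc)

lemma cscale_mult_right: "A ** cscale c B = cscale c (A ** B)"
  by (simp add: cscale_def map_matrix_def matrix_matrix_mult_def vec_eq_iff sum_distrib_left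
      mult.left_commute)

lemma cscale_cscale: "cscale c (cscale d A) = cscale (c * d) A"
  by (simp add: cscale_def map_matrix_def vec_eq_iff)

lemma cscale_1 [simp]: "cscale 1 A = A"
  by (simp add: cscale_def map_matrix_def vec_eq_iff)

lemma bounded_linear_cscale_left: "bounded_linear (\<lambda>c. cscale c A)"
  unfolding linear_conv_bounded_linear [symmetric]
  by (auto simp: linear_iff cscale_def map_matrix_def vec_eq_iff algebra_simps)

lemma bounded_linear_conj_transpose: "bounded_linear conj_transpose"
  unfolding linear_conv_bounded_linear [symmetric]
  by (auto simp: linear_iff conj_transpose_def map_matrix_def transpose_def vec_eq_iff)

lemma conj_transpose_mult: "conj_transpose (A ** B) = conj_transpose B ** conj_transpose A"
  by (simp add: conj_transpose_def map_matrix_def transpose_def matrix_matrix_mult_def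
      vec_eq_iff mult.commute)

lemma conj_transpose_conj_transpose [simp]: "conj_transpose (conj_transpose A) = A"
  by (simp add: conj_transpose_def map_matrix_def transpose_def vec_eq_iff)

lemma conj_transpose_0 [simp]: "conj_transpose 0 = 0"
  by (simp add: conj_transpose_def map_matrix_def transpose_def vec_eq_iff)

lemma bounded_linear_column: "bounded_linear (column j :: complex^'n^'m \<Rightarrow> complex^'m)"
  unfolding linear_conv_bounded_linear [symmetric]
  by (auto simp: linear_iff column_def vec_eq_iff)

lemma column_matrix_mult: "column j (A ** B) = A *v column j B"
  by (simp add: column_def matrix_matrix_mult_def matrix_vector_mult_def vec_eq_iff)

lemma norm_column_le: "norm (column j (A :: complex^'n^'m)) \<le> norm A"
  unfolding norm_vec_def[of A] norm_vec_def[of "column j A"]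
  by (rule L2_set_mono) (auto simp: column_def Finite_Cartesian_Product.norm_nth_le)

text \<open>Together with \<open>norm_column_le\<close> this carries L1 estimates for vector
  functions over to matrix functions, one column at a time.\<close>

lemma norm_le_sum_norm_column: "norm (A :: complex^'n^'m) \<le> (\<Sum>j\<in>UNIV. norm (column j A))"
proof -
  \<comment> \<open>The matrix is the sum of its columns, each padded with zeros to a full matrix;
    the triangle inequality then applies.\<close>
  have A: "A = (\<Sum>j\<in>UNIV. (\<chi> i l. if l = j then column j A $ i else 0))"
    by (simp add: vec_eq_iff column_def sum.delta)
  have "norm (\<chi> i l. if l = j then column j A $ i else 0) = norm (column j A)" for j
  proof -
    have "norm (\<chi> l. if l = j then column j A $ i else 0) = norm (column j A $ i)" for i
      by (simp add: norm_vec_def L2_set_def if_distrib[of "\<lambda>z. (norm z)\<^sup>2"] sum.delta cong: if_cong)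
    then show ?thesis
      unfolding norm_vec_def[of "column j A"]
      by (subst norm_vec_def) simp
  qed
  then show ?thesis
    by (subst A) (metis (mono_tags, lifting) norm_sum sum.cong)
qed

lemma bounded_linear_block_row_left: "bounded_linear (\<lambda>A. block_row A 0)"
  unfolding linear_conv_bounded_linear [symmetric]
  by (auto simp: linear_iff block_row_def vec_eq_iff split: sum.splits)

lemma bounded_linear_block_row_right: "bounded_linear (\<lambda>B. block_row 0 B)"
  unfolding linear_conv_bounded_linear [symmetric]
  by (auto simp: linear_iff block_row_def vec_eq_iff split: sum.splits)

lemma block_row_add: "block_row A B = block_row A 0 + block_row 0 B"
  by (auto simp: block_row_def vec_eq_iff split: sum.splits)

lemma sum_UNIV_sum:
  "(\<Sum>k\<in>UNIV. f k) = (\<Sum>k\<in>UNIV. f (Inl k)) + (\<Sum>k\<in>UNIV. f (Inr k))"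
  for f :: "'a::finite + 'b::finite \<Rightarrow> 'c::comm_monoid_add"
  by (simp add: UNIV_Plus_UNIV[symmetric] sum.Plus del: UNIV_Plus_UNIV)

lemma block_row_mult_block_mat:
  "block_row P Q ** block_mat A B C D = block_row (P ** A + Q ** C) (P ** B + Q ** D)"
  by (simp add: block_row_def block_mat_def matrix_matrix_mult_def vec_eq_iff sum_UNIV_sum
      split: sum.splits)

lemma cscale_block_mat:
  "cscale c (block_mat A B C D) = block_mat (cscale c A) (cscale c B) (cscale c C) (cscale c D)"
  by (auto simp: block_row_def block_mat_def cscale_def map_matrix_def vec_eq_iff split: sum.splits)

lemma block_mat_add:
  "block_mat A B C D + block_mat A' B' C' D' = block_mat (A + A') (B + B') (C + C') (D + D')"
  by (auto simp: block_row_def block_mat_def vec_eq_iff split: sum.splits)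

section \<open>Convolution with a bounded kernel\<close>

text \<open>Between \<tau> and \<sigma> the integrand stays within \<open>e\<close> of
  \<open>L\<close>, so its signed integral differs from that of the constant \<open>L\<close> by at
  most \<open>e\<close> times the length. With \<open>L\<close> = 0 this is a Lipschitz bound, with
  \<open>L\<close> a limit value it controls a difference quotient.\<close>

lemma integral_increment_bound:
  fixes g :: "real \<Rightarrow> 'a::euclidean_space"
  assumes g: "g integrable_on {0..T}" and \<sigma>: "\<sigma> \<in> {0..T}" and \<tau>: "\<tau> \<in> {0..T}"
    and e: "\<And>v. v \<in> {0..T} \<Longrightarrow> \<bar>v - \<tau>\<bar> \<le> \<bar>\<sigma> - \<tau>\<bar> \<Longrightarrow> norm (g v - L) \<le> e"
  shows "norm (integral {0..\<sigma>} g - integral {0..\<tau>} g - (\<sigma> - \<tau>) *\<^sub>R L) \<le> e * \<bar>\<sigma> - \<tau>\<bar>"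
proof -
  have *: "norm (integral {a..b} g - (b - a) *\<^sub>R L) \<le> e * (b - a)"
    if "0 \<le> a" "a \<le> b" "b \<le> T" "\<And>v. v \<in> {a..b} \<Longrightarrow> norm (g v - L) \<le> e" for a b
  proof -
    have gi: "g integrable_on {a..b}"
      using g by (rule integrable_on_subinterval) (use that in auto)
    have "integral {a..b} g - (b - a) *\<^sub>R L = integral {a..b} (\<lambda>v. g v - L)"
      using gi that by (subst integral_diff) auto
    moreover have "norm (integral {a..b} (\<lambda>v. g v - L)) \<le> e * measure lborel {a..b}"
      unfolding box_real(2)[symmetric]
    proof (rule Henstock_Kurzweil_Integration.integrable_bound)
      show "0 \<le> e"
        using that(2) that(4)[of a] by (meson atLeastAtMost_iff norm_ge_zero order_trans order_refl)
      show "(\<lambda>v. g v - L) integrable_on cbox a b"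
        using gi by (auto intro!: integrable_diff)
    qed (use that in auto)
    ultimately show ?thesis using that by simp
  qed
  show ?thesis
  proof (cases "\<sigma> \<le> \<tau>")
    case True
    have "integral {0..\<sigma>} g + integral {\<sigma>..\<tau>} g = integral {0..\<tau>} g"
      by (rule Henstock_Kurzweil_Integration.integral_combine)
        (use True \<sigma> \<tau> g in \<open>auto intro: integrable_on_subinterval\<close>)
    then have "integral {0..\<sigma>} g - integral {0..\<tau>} g - (\<sigma> - \<tau>) *\<^sub>R L
        = - (integral {\<sigma>..\<tau>} g - (\<tau> - \<sigma>) *\<^sub>R L)"
      by (simp add: algebra_simps)
    also have "norm \<dots> \<le> e * (\<tau> - \<sigma>)"
      unfolding norm_minus_cancel by (rule *) (use True \<sigma> \<tau> in \<open>auto intro!: e\<close>)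
    finally show ?thesis using True by simp
  next
    case False
    have "integral {0..\<tau>} g + integral {\<tau>..\<sigma>} g = integral {0..\<sigma>} g"
      by (rule Henstock_Kurzweil_Integration.integral_combine)
        (use False \<sigma> \<tau> g in \<open>auto intro: integrable_on_subinterval\<close>)
    then have "integral {0..\<sigma>} g - integral {0..\<tau>} g - (\<sigma> - \<tau>) *\<^sub>R L
        = integral {\<tau>..\<sigma>} g - (\<sigma> - \<tau>) *\<^sub>R L"
      by (simp add: algebra_simps)
    also have "norm \<dots> \<le> e * (\<sigma> - \<tau>)"
      by (rule *) (use False \<sigma> \<tau> in \<open>auto intro!: e\<close>)
    finally show ?thesis using False by simp
  qed
qed

text \<open>The integral operator acts on matrix functions, which treats all columns of a resolvent
  kernel at once. The point \<open>x\<close> is not confined to the interval of integration; this is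
  what extends solutions beyond \<tau>.\<close>

definition mconv :: "(real \<Rightarrow> complex^'r^'r) \<Rightarrow> real \<Rightarrow> (real \<Rightarrow> complex^'r^'r) \<Rightarrow> real \<Rightarrow> complex^'r^'r"
  where "mconv \<kappa> \<tau> f x = integral {0..\<tau>} (\<lambda>v. \<kappa> (x - v) ** f v)"

lemma borel_measurable_lebesgue_on:
  "f \<in> borel_measurable borel \<Longrightarrow> f \<in> borel_measurable (lebesgue_on S)"
  by (intro measurable_restrict_space1 measurable_completion) simp

lemma continuous_mult_integrable:
  fixes \<phi> f :: "real \<Rightarrow> complex^'r^'r"
  assumes \<phi>: "continuous_on {0..T} \<phi>" and \<tau>: "\<tau> \<le> T" and f: "f absolutely_integrable_on {0..\<tau>}"
  shows "(\<lambda>x. \<phi> x ** f x) absolutely_integrable_on {0..\<tau>}"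
proof (rule absolutely_integrable_bounded_measurable_product[OF bilinear_matrix_mult])
  have c: "continuous_on {0..\<tau>} \<phi>" by (rule continuous_on_subset[OF \<phi>]) (use \<tau> in auto)
  then show "\<phi> \<in> borel_measurable (lebesgue_on {0..\<tau>})"
    by (intro continuous_imp_measurable_on_sets_lebesgue) auto
  show "bounded (\<phi> ` {0..\<tau>})"
    by (intro compact_imp_bounded compact_continuous_image c) auto
qed (use f in auto)

text \<open>The kernel lives on the whole line, and its value at 0 is unrelated to its limits there,
  which admits a jump. The number \<open>N\<close> bounds left multiplication by kernel values, so
  it absorbs the constant of the matrix product.\<close>

locale bounded_kernel =
  fixes T :: real and \<kappa> :: "real \<Rightarrow> complex^'r^'r" and N :: real
  assumes kernel_measurable: "\<kappa> \<in> borel_measurable borel"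
    and kernel_bound: "\<And>x A. norm (\<kappa> x ** A) \<le> N * norm (A :: complex^'r^'r)"
    and kernel_bounded: "bounded (range \<kappa>)"
    and kernel_continuous: "continuous_on ({-T..T} - {0}) \<kappa>"
    and N_pos: "0 < N"
begin

lemma conv_integrand:
  assumes "f absolutely_integrable_on {0..\<tau>}"
  shows "(\<lambda>v. \<kappa> (x - v) ** f v) absolutely_integrable_on {0..\<tau>}"
proof (rule absolutely_integrable_bounded_measurable_product[OF bilinear_matrix_mult])
  show "(\<lambda>v. \<kappa> (x - v)) \<in> borel_measurable (lebesgue_on {0..\<tau>})"
    by (rule borel_measurable_lebesgue_on, rule measurable_compose[OF _ kernel_measurable]) simp
  show "bounded ((\<lambda>v. \<kappa> (x - v)) ` {0..\<tau>})"
    by (rule bounded_subset[OF kernel_bounded]) auto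
qed (use assms in auto)

lemma kernel_integrable: "(\<lambda>x. \<kappa> (x - a)) absolutely_integrable_on {0..\<tau>}"
proof -
  have "(\<lambda>x. \<kappa> (x - a) ** mat 1) absolutely_integrable_on {0..\<tau>}"
  proof (rule absolutely_integrable_bounded_measurable_product[OF bilinear_matrix_mult])
    show "(\<lambda>x. \<kappa> (x - a)) \<in> borel_measurable (lebesgue_on {0..\<tau>})"
      by (rule borel_measurable_lebesgue_on, rule measurable_compose[OF _ kernel_measurable]) simp
    show "bounded ((\<lambda>x. \<kappa> (x - a)) ` {0..\<tau>})"
      by (rule bounded_subset[OF kernel_bounded]) auto
  qed (auto intro: absolutely_integrable_on_const)
  then show ?thesis by simp
qed

lemma conv_integrable:
  "f absolutely_integrable_on {0..\<tau>} \<Longrightarrow> (\<lambda>v. \<kappa> (x - v) ** f v) integrable_on {0..\<tau>}"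
  using conv_integrand set_lebesgue_integral_eq_integral(1) by blast

lemma norm_conv_le:
  assumes f: "f absolutely_integrable_on {0..\<tau>}"
  shows "norm (mconv \<kappa> \<tau> f x) \<le> N * integral {0..\<tau>} (\<lambda>v. norm (f v))"
proof -
  have "norm (mconv \<kappa> \<tau> f x) \<le> integral {0..\<tau>} (\<lambda>v. N * norm (f v))"
    unfolding mconv_def
    by (rule integral_norm_bound_integral)
      (use f conv_integrable in \<open>auto simp: kernel_bound absolutely_integrable_on_def intro: integrable_on_mult_right\<close>)
  then show ?thesis by simp
qed

lemma conv_diff:
  assumes f: "f absolutely_integrable_on {0..\<tau>}" and g: "g absolutely_integrable_on {0..\<tau>}"
  shows "mconv \<kappa> \<tau> (\<lambda>v. f v - g v) x = mconv \<kappa> \<tau> f x - mconv \<kappa> \<tau> g x"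
  unfolding mconv_def
  by (simp add: mm.diff_right integral_diff conv_integrable f g)

lemma conv_scaleR: "mconv \<kappa> \<tau> (\<lambda>v. c *\<^sub>R f v) x = c *\<^sub>R mconv \<kappa> \<tau> f x"
  unfolding mconv_def by (simp add: mm.scaleR_right)

lemma conv_mult_right:
  assumes f: "f absolutely_integrable_on {0..\<tau>}"
  shows "mconv \<kappa> \<tau> (\<lambda>v. f v ** A) x = mconv \<kappa> \<tau> f x ** A"
  using integral_linear[OF conv_integrable[OF f] mm.bounded_linear_left[of A], of x]
  by (simp add: mconv_def o_def matrix_mul_assoc)

text \<open>For each \<open>x\<close> the discontinuity of the kernel is met only at the single
  point \<open>v = x\<close>. Setting the integrand to 0 there leaves the integral unchanged and
  gives pointwise convergence everywhere, so dominated convergence applies.\<close>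

lemma continuous_on_conv:
  assumes f: "f absolutely_integrable_on {0..\<tau>}" and \<tau>: "\<tau> \<le> T"
  shows "continuous_on {0..T} (mconv \<kappa> \<tau> f)"
  unfolding continuous_on_sequentially
proof (intro allI ballI impI, elim conjE)
  fix u :: "nat \<Rightarrow> real" and x assume x: "x \<in> {0..T}" and u: "\<forall>n. u n \<in> {0..T}" and lim: "u \<longlonglongrightarrow> x"
  have spike: "mconv \<kappa> \<tau> f y = integral {0..\<tau>} (\<lambda>v. if v = x then 0 else \<kappa> (y - v) ** f v)" for y
    unfolding mconv_def by (rule integral_spike[of "{x}"]) auto
  have "(\<lambda>n. integral {0..\<tau>} (\<lambda>v. if v = x then 0 else \<kappa> (u n - v) ** f v)) \<longlonglongrightarrow>
      integral {0..\<tau>} (\<lambda>v. if v = x then 0 else \<kappa> (x - v) ** f v)"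
  proof (rule dominated_convergence)
    show "(\<lambda>v. if v = x then 0 else \<kappa> (u n - v) ** f v) integrable_on {0..\<tau>}" for n
      by (rule integrable_spike[OF conv_integrable[OF f, of "u n"], of "{x}"]) auto
    show "(\<lambda>v. N * norm (f v)) integrable_on {0..\<tau>}"
      using f by (auto simp: absolutely_integrable_on_def intro: integrable_on_mult_right)
    show "norm (if v = x then 0 else \<kappa> (u n - v) ** f v) \<le> N * norm (f v)" for n v
      using N_pos by (auto simp: kernel_bound)
    show "(\<lambda>n. if v = x then 0 else \<kappa> (u n - v) ** f v) \<longlonglongrightarrow> (if v = x then 0 else \<kappa> (x - v) ** f v)"
      if v: "v \<in> {0..\<tau>}" for v
    proof (cases "v = x")
      case False
      have l: "(\<lambda>n. u n - v) \<longlonglongrightarrow> x - v" using lim by (intro tendsto_intros)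
      have "(\<lambda>n. \<kappa> (u n - v)) \<longlonglongrightarrow> \<kappa> (x - v)"
      proof (rule continuous_on_tendsto_compose[OF kernel_continuous l])
        show "x - v \<in> {-T..T} - {0}" using v x \<tau> False by auto
        have "\<forall>\<^sub>F n in sequentially. u n - v \<noteq> 0"
          using False by (intro tendsto_imp_eventually_ne[OF l]) simp
        then show "\<forall>\<^sub>F n in sequentially. u n - v \<in> {-T..T} - {0}"
          by (rule eventually_mono) (use u v \<tau> in \<open>simp, smt (verit)\<close>)
      qed
      then show ?thesis using False by (auto intro!: mm.tendsto)
    qed simp
  qed
  then show "(mconv \<kappa> \<tau> f \<circ> u) \<longlonglongrightarrow> mconv \<kappa> \<tau> f x"
    unfolding o_def spike .
qed

end

section \<open>Dependence of the solution on the interval\<close>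

text \<open>The scaled difference is the mean of \<open>g n\<close> over the interval between \<tau>
  and \<open>s n\<close>, which shrinks to \<tau>. The integrand may vary with \<open>n\<close>,
  because the solutions to be averaged change together with the endpoint.\<close>

lemma average_tendsto:
  fixes g :: "nat \<Rightarrow> real \<Rightarrow> 'a::euclidean_space"
  assumes \<tau>: "\<tau> \<in> {0..T}" and s: "\<And>n. s n \<in> {0..T}" "\<And>n. s n \<noteq> \<tau>" and lim: "s \<longlonglongrightarrow> \<tau>"
    and g: "\<And>n. g n integrable_on {0..T}"
    and gL: "\<And>v. (\<And>n. v n \<in> {0..T}) \<Longrightarrow> v \<longlonglongrightarrow> \<tau> \<Longrightarrow> (\<lambda>n. g n (v n)) \<longlonglongrightarrow> L"
  shows "(\<lambda>n. (1 / (s n - \<tau>)) *\<^sub>R (integral {0..s n} (g n) - integral {0..\<tau>} (g n))) \<longlonglongrightarrow> L"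
proof (rule metric_LIMSEQ_I)
  fix e :: real assume e: "0 < e"
  \<comment> \<open>Sequential convergence is turned into a uniform bound by letting \<open>v n\<close> pick a violating point, if any.\<close>
  define bad where "bad n v \<longleftrightarrow> v \<in> {0..T} \<and> \<bar>v - \<tau>\<bar> \<le> \<bar>s n - \<tau>\<bar> \<and> norm (g n v - L) > e / 2" for n v
  define v where "v n = (if \<exists>u. bad n u then SOME u. bad n u else \<tau>)" for n
  have v_bad: "bad n (v n)" if "bad n u" for n u
    using that someI[of "bad n" u] by (auto simp: v_def)
  have "v n \<in> {0..T} \<and> \<bar>v n - \<tau>\<bar> \<le> \<bar>s n - \<tau>\<bar>" for n
  proof (cases "\<exists>u. bad n u")
    case True
    then have "bad n (v n)" using v_bad by blast
    then show ?thesis by (simp add: bad_def)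
  qed (use \<tau> in \<open>simp add: v_def\<close>)
  then have v: "v n \<in> {0..T}" "\<bar>v n - \<tau>\<bar> \<le> \<bar>s n - \<tau>\<bar>" for n by blast+
  have "(\<lambda>n. \<bar>s n - \<tau>\<bar>) \<longlonglongrightarrow> 0"
    using tendsto_rabs[OF tendsto_diff[OF lim tendsto_const[of \<tau>]]] by simp
  then have "(\<lambda>n. v n - \<tau>) \<longlonglongrightarrow> 0"
    by (rule Lim_null_comparison[rotated]) (use v(2) in auto)
  then have "v \<longlonglongrightarrow> \<tau>" by (simp add: LIM_zero_iff)
  from metric_LIMSEQ_D[OF gL[OF v(1) this], of "e/2"] e
  obtain n0 where n0: "\<And>n. n \<ge> n0 \<Longrightarrow> dist (g n (v n)) L < e / 2" by auto
  have "dist ((1 / (s n - \<tau>)) *\<^sub>R (integral {0..s n} (g n) - integral {0..\<tau>} (g n))) L < e"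
    if n: "n \<ge> n0" for n
  proof -
    let ?d = "integral {0..s n} (g n) - integral {0..\<tau>} (g n)"
    have "norm (g n u - L) \<le> e / 2" if "u \<in> {0..T}" "\<bar>u - \<tau>\<bar> \<le> \<bar>s n - \<tau>\<bar>" for u
    proof (rule ccontr)
      assume "\<not> ?thesis"
      then have "bad n u" using that by (simp add: bad_def)
      from v_bad[OF this] show False using n0[OF n] by (simp add: bad_def dist_norm)
    qed
    then have *: "norm (?d - (s n - \<tau>) *\<^sub>R L) \<le> e / 2 * \<bar>s n - \<tau>\<bar>"
      by (intro integral_increment_bound[OF g s(1) \<tau>])
    have "(1 / (s n - \<tau>)) *\<^sub>R ?d - L = (1 / (s n - \<tau>)) *\<^sub>R (?d - (s n - \<tau>) *\<^sub>R L)"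
      using s(2)[of n] by (simp add: scaleR_diff_right)
    also have "norm \<dots> = norm (?d - (s n - \<tau>) *\<^sub>R L) / \<bar>s n - \<tau>\<bar>"
      by simp
    also have "\<dots> \<le> e / 2"
      using * s(2)[of n] by (simp add: divide_le_eq)
    finally show ?thesis using e by (simp add: dist_norm)
  qed
  then show "\<exists>n0. \<forall>n\<ge>n0. dist ((1 / (s n - \<tau>)) *\<^sub>R (integral {0..s n} (g n) - integral {0..\<tau>} (g n))) L < e"
    by blast
qed

text \<open>The form in which the invertibility of the operator enters the estimates: the norm of an
  inverse, stated for matrix functions. The constant may depend on \<tau>.\<close>

definition a_priori_bound :: "(real \<Rightarrow> complex^'r^'r) \<Rightarrow> real \<Rightarrow> bool" where
  "a_priori_bound \<kappa> \<tau> \<longleftrightarrow> (\<exists>C. \<forall>f. f absolutely_integrable_on {0..\<tau>} \<longrightarrow>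
     integral {0..\<tau>} (\<lambda>x. norm (f x)) \<le> C * integral {0..\<tau>} (\<lambda>x. norm (f x - mconv \<kappa> \<tau> f x)))"

text \<open>Each \<open>X \<tau>\<close> solves the equation with integration over [0,\<tau>], but
  is extended by that equation to all of [0,T]. All solutions thus share one domain and can be
  subtracted. The case \<tau> = 0 is included and gives \<open>X 0 = h\<close> on [0,T].\<close>

locale conv_family = bounded_kernel T \<kappa> N
  for T :: real and \<kappa> :: "real \<Rightarrow> complex^'r^'r" and N :: real +
  fixes h :: "real \<Rightarrow> complex^'r^'r" and X :: "real \<Rightarrow> real \<Rightarrow> complex^'r^'r"
  assumes T_pos: "0 < T"
    and a_priori: "\<And>\<tau>. \<tau> \<in> {0..T} \<Longrightarrow> a_priori_bound \<kappa> \<tau>"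
    and X_cont: "\<And>\<tau>. \<tau> \<in> {0..T} \<Longrightarrow> continuous_on {0..T} (X \<tau>)"
    and X_eq: "\<And>\<tau> x. \<tau> \<in> {0..T} \<Longrightarrow> x \<in> {0..T} \<Longrightarrow> X \<tau> x = h x + mconv \<kappa> \<tau> (X \<tau>) x"
begin

lemma X_absolutely_integrable:
  "\<sigma> \<in> {0..T} \<Longrightarrow> \<tau> \<le> T \<Longrightarrow> X \<sigma> absolutely_integrable_on {0..\<tau>}"
  by (rule absolutely_integrable_continuous_real) (rule continuous_on_subset[OF X_cont], auto)

text \<open>This is the integral of \<open>\<kappa> (x - v) ** X \<sigma> v\<close> over
  \<open>v\<close> from \<tau> to \<sigma>, written as a difference so that either endpoint may be
  the larger one.\<close>

definition incr :: "real \<Rightarrow> real \<Rightarrow> real \<Rightarrow> complex^'r^'r"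
  where "incr \<tau> \<sigma> x = mconv \<kappa> \<sigma> (X \<sigma>) x - mconv \<kappa> \<tau> (X \<sigma>) x"

lemma increment_equation:
  assumes \<tau>: "\<tau> \<in> {0..T}" and \<sigma>: "\<sigma> \<in> {0..T}" and x: "x \<in> {0..T}"
  shows "X \<sigma> x - X \<tau> x - mconv \<kappa> \<tau> (\<lambda>v. X \<sigma> v - X \<tau> v) x = incr \<tau> \<sigma> x"
  using \<tau> \<sigma> X_eq[OF \<tau> x] X_eq[OF \<sigma> x]
  by (simp add: conv_diff X_absolutely_integrable incr_def)

lemma continuous_on_incr:
  "\<tau> \<in> {0..T} \<Longrightarrow> \<sigma> \<in> {0..T} \<Longrightarrow> continuous_on {0..T} (incr \<tau> \<sigma>)"
  unfolding incr_def
  by (intro continuous_on_diff continuous_on_conv X_absolutely_integrable) auto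

lemma norm_incr_le:
  assumes \<tau>: "\<tau> \<in> {0..T}" and \<sigma>: "\<sigma> \<in> {0..T}" and S: "\<And>v. v \<in> {0..T} \<Longrightarrow> norm (X \<sigma> v) \<le> S"
  shows "norm (incr \<tau> \<sigma> x) \<le> N * S * \<bar>\<sigma> - \<tau>\<bar>"
proof -
  have "norm (incr \<tau> \<sigma> x - (\<sigma> - \<tau>) *\<^sub>R 0) \<le> N * S * \<bar>\<sigma> - \<tau>\<bar>"
    unfolding incr_def mconv_def
  proof (rule integral_increment_bound[OF _ \<sigma> \<tau>])
    show "(\<lambda>v. \<kappa> (x - v) ** X \<sigma> v) integrable_on {0..T}"
      by (intro conv_integrable X_absolutely_integrable \<sigma> order_refl)
    show "norm (\<kappa> (x - v) ** X \<sigma> v - 0) \<le> N * S" if "v \<in> {0..T}" for v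
      using kernel_bound[of "x - v" "X \<sigma> v"] S[OF that] N_pos
      by (smt (verit) diff_zero mult_left_mono)
  qed
  then show ?thesis by simp
qed

text \<open>By \<open>increment_equation\<close> and the a priori bound at the fixed \<tau>, the
  difference is at most a constant times |\<sigma> - \<tau>| times the supremum of
  \<open>X \<sigma>\<close>. Near \<tau> that supremum is absorbed, leaving a bound in terms of
  \<open>X \<tau>\<close> alone. No bound uniform in \<tau> enters.\<close>

lemma X_locally_Lipschitz:
  assumes \<tau>: "\<tau> \<in> {0..T}"
  shows "\<exists>\<delta>>0. \<exists>L. \<forall>\<sigma>\<in>{0..T}. \<bar>\<sigma> - \<tau>\<bar> < \<delta> \<longrightarrow> (\<forall>x\<in>{0..T}. norm (X \<sigma> x - X \<tau> x) \<le> L * \<bar>\<sigma> - \<tau>\<bar>)"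
proof -
  obtain C0 where C0: "\<And>f. f absolutely_integrable_on {0..\<tau>} \<Longrightarrow>
      integral {0..\<tau>} (\<lambda>x. norm (f x)) \<le> C0 * integral {0..\<tau>} (\<lambda>x. norm (f x - mconv \<kappa> \<tau> f x))"
    using a_priori[OF \<tau>] unfolding a_priori_bound_def by blast
  define C where "C = max C0 0"
  \<comment> \<open>The first summand estimates \<open>incr\<close>. The second estimates the
    convolution of the difference: a factor \<open>N\<close>, times the a priori constant, times the
    L1 norm of \<open>incr\<close> over an interval of length at most \<open>T\<close>.\<close>
  define A where "A = N + N * (C * (N * T))"
  have C: "0 \<le> C" by (simp add: C_def)
  have A: "0 < A" using N_pos C T_pos by (simp add: A_def add_pos_nonneg)
  have D: "norm (X \<sigma> x - X \<tau> x) \<le> A * S * \<bar>\<sigma> - \<tau>\<bar>"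
    if \<sigma>: "\<sigma> \<in> {0..T}" and x: "x \<in> {0..T}" and S: "\<And>v. v \<in> {0..T} \<Longrightarrow> norm (X \<sigma> v) \<le> S" for \<sigma> x S
  proof -
    define D where "D v = X \<sigma> v - X \<tau> v" for v
    have Dint: "D absolutely_integrable_on {0..\<tau>}"
      unfolding D_def using \<tau> \<sigma> by (intro set_integral_diff X_absolutely_integrable) auto
    have S0: "0 \<le> S" using S[OF x] by (meson norm_ge_zero order_trans)
    have "integral {0..\<tau>} (\<lambda>x. norm (D x - mconv \<kappa> \<tau> D x)) = integral {0..\<tau>} (\<lambda>x. norm (incr \<tau> \<sigma> x))"
      unfolding D_def using \<tau> \<sigma> by (intro integral_cong) (subst increment_equation, auto)
    also have "\<dots> \<le> integral {0..\<tau>} (\<lambda>x. N * S * \<bar>\<sigma> - \<tau>\<bar>)"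
    proof (rule integral_le)
      show "(\<lambda>x. norm (incr \<tau> \<sigma> x)) integrable_on {0..\<tau>}"
        using \<tau> continuous_on_incr[OF \<tau> \<sigma>]
        by (intro integrable_continuous_real continuous_on_norm) (auto elim: continuous_on_subset)
    qed (auto intro!: norm_incr_le \<tau> \<sigma> S)
    also have "\<dots> = N * S * \<bar>\<sigma> - \<tau>\<bar> * \<tau>"
      using \<tau> by simp
    also have "\<dots> \<le> N * S * \<bar>\<sigma> - \<tau>\<bar> * T"
      using \<tau> N_pos S0 by (intro mult_left_mono) simp_all
    finally have 1: "integral {0..\<tau>} (\<lambda>x. norm (D x - mconv \<kappa> \<tau> D x)) \<le> N * S * \<bar>\<sigma> - \<tau>\<bar> * T" .
    have I0: "0 \<le> integral {0..\<tau>} (\<lambda>x. norm (D x - mconv \<kappa> \<tau> D x))"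
      by (cases "(\<lambda>x. norm (D x - mconv \<kappa> \<tau> D x)) integrable_on {0..\<tau>}")
        (auto intro: integral_nonneg simp: not_integrable_integral)
    have "integral {0..\<tau>} (\<lambda>x. norm (D x)) \<le> C0 * integral {0..\<tau>} (\<lambda>x. norm (D x - mconv \<kappa> \<tau> D x))"
      by (rule C0[OF Dint])
    also have "\<dots> \<le> C * integral {0..\<tau>} (\<lambda>x. norm (D x - mconv \<kappa> \<tau> D x))"
      using I0 by (intro mult_right_mono) (auto simp: C_def)
    also have "\<dots> \<le> C * (N * S * \<bar>\<sigma> - \<tau>\<bar> * T)"
      by (rule mult_left_mono[OF 1 C])
    finally have 2: "N * integral {0..\<tau>} (\<lambda>x. norm (D x)) \<le> N * (C * (N * S * \<bar>\<sigma> - \<tau>\<bar> * T))"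
      using N_pos by simp
    have "D x = incr \<tau> \<sigma> x + mconv \<kappa> \<tau> D x"
      using increment_equation[OF \<tau> \<sigma> x] by (simp add: D_def[abs_def] algebra_simps)
    then have "norm (D x) \<le> norm (incr \<tau> \<sigma> x) + norm (mconv \<kappa> \<tau> D x)"
      by (metis norm_triangle_ineq)
    also have "\<dots> \<le> N * S * \<bar>\<sigma> - \<tau>\<bar> + N * (C * (N * S * \<bar>\<sigma> - \<tau>\<bar> * T))"
      using norm_incr_le[OF \<tau> \<sigma> S, of x] norm_conv_le[OF Dint, of x] 2 by linarith
    also have "\<dots> = A * S * \<bar>\<sigma> - \<tau>\<bar>" by (simp add: A_def algebra_simps)
    finally show ?thesis by (simp add: D_def)
  qed
  have sup: "\<exists>x\<in>{0..T}. \<forall>v\<in>{0..T}. norm (X \<sigma> v) \<le> norm (X \<sigma> x)" if "\<sigma> \<in> {0..T}" for \<sigma>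
    using T_pos by (intro continuous_attains_sup continuous_on_norm X_cont that) auto
  from sup[OF \<tau>] obtain x0 where x0: "\<And>v. v \<in> {0..T} \<Longrightarrow> norm (X \<tau> v) \<le> norm (X \<tau> x0)" by blast
  \<comment> \<open>The radius \<open>1 / (2 * A)\<close> makes the supremum of
    \<open>X \<sigma>\<close> at most the supremum of \<open>X \<tau>\<close> plus half of itself,
    hence at most twice the supremum of \<open>X \<tau>\<close>.\<close>
  have "norm (X \<sigma> x - X \<tau> x) \<le> A * (2 * norm (X \<tau> x0)) * \<bar>\<sigma> - \<tau>\<bar>"
    if \<sigma>: "\<sigma> \<in> {0..T}" and near: "\<bar>\<sigma> - \<tau>\<bar> < 1 / (2 * A)" and x: "x \<in> {0..T}" for \<sigma> x
  proof -
    from sup[OF \<sigma>] obtain x1 where x1: "x1 \<in> {0..T}" "\<And>v. v \<in> {0..T} \<Longrightarrow> norm (X \<sigma> v) \<le> norm (X \<sigma> x1)"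
      by blast
    have "norm (X \<sigma> x1) \<le> norm (X \<tau> x1) + norm (X \<sigma> x1 - X \<tau> x1)"
      by (metis norm_triangle_sub)
    also have "\<dots> \<le> norm (X \<tau> x0) + A * norm (X \<sigma> x1) * \<bar>\<sigma> - \<tau>\<bar>"
      using x0[OF x1(1)] D[OF \<sigma> x1] by linarith
    also have "A * norm (X \<sigma> x1) * \<bar>\<sigma> - \<tau>\<bar> = norm (X \<sigma> x1) * (A * \<bar>\<sigma> - \<tau>\<bar>)" by simp
    also have "\<dots> \<le> norm (X \<sigma> x1) * (1/2)"
      using near A by (intro mult_left_mono) (auto simp: field_simps)
    finally have "norm (X \<sigma> x1) \<le> 2 * norm (X \<tau> x0)" by simp
    then have "norm (X \<sigma> v) \<le> 2 * norm (X \<tau> x0)" if "v \<in> {0..T}" for v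
      using x1(2)[OF that] by linarith
    from D[OF \<sigma> x this] show ?thesis .
  qed
  moreover have "0 < 1 / (2 * A)" using A by simp
  ultimately show ?thesis by blast
qed

text \<open>The Lipschitz estimate in the length is uniform in \<open>x\<close>, so it combines with
  the continuity of the single function \<open>X \<tau>\<close>.\<close>

lemma X_jointly_tendsto:
  assumes \<tau>: "\<tau> \<in> {0..T}" and s: "\<And>n. s n \<in> {0..T}" "s \<longlonglongrightarrow> \<tau>"
    and v: "\<And>n. v n \<in> {0..T}" "v \<longlonglongrightarrow> x" and x: "x \<in> {0..T}"
  shows "(\<lambda>n. X (s n) (v n)) \<longlonglongrightarrow> X \<tau> x"
proof -
  obtain \<delta> L where \<delta>: "0 < \<delta>" and L: "\<And>\<sigma> x. \<sigma> \<in> {0..T} \<Longrightarrow> \<bar>\<sigma> - \<tau>\<bar> < \<delta> \<Longrightarrow> x \<in> {0..T} \<Longrightarrow>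
      norm (X \<sigma> x - X \<tau> x) \<le> L * \<bar>\<sigma> - \<tau>\<bar>"
    using X_locally_Lipschitz[OF \<tau>] by metis
  have sl: "(\<lambda>n. \<bar>s n - \<tau>\<bar>) \<longlonglongrightarrow> 0"
    using tendsto_rabs[OF tendsto_diff[OF s(2) tendsto_const[of \<tau>]]] by simp
  have "\<forall>\<^sub>F n in sequentially. norm (X (s n) (v n) - X \<tau> (v n)) \<le> L * \<bar>s n - \<tau>\<bar>"
    using order_tendstoD(2)[OF sl \<delta>] by (rule eventually_mono) (rule L[OF s(1) _ v(1)])
  moreover have "(\<lambda>n. L * \<bar>s n - \<tau>\<bar>) \<longlonglongrightarrow> 0"
    using tendsto_mult[OF tendsto_const[of L] sl] by simp
  ultimately have "(\<lambda>n. X (s n) (v n) - X \<tau> (v n)) \<longlonglongrightarrow> 0"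
    by (rule Lim_null_comparison)
  moreover have "(\<lambda>n. X \<tau> (v n)) \<longlonglongrightarrow> X \<tau> x"
    by (rule continuous_on_tendsto_compose[OF X_cont[OF \<tau>] v(2) x]) (use v in auto)
  ultimately have "(\<lambda>n. (X (s n) (v n) - X \<tau> (v n)) + X \<tau> (v n)) \<longlonglongrightarrow> 0 + X \<tau> x"
    by (rule tendsto_add)
  then show ?thesis by simp
qed

lemma continuous_on_X_diagonal: "continuous_on {0..T} (\<lambda>\<tau>. X \<tau> \<tau>)"
  unfolding continuous_on_sequentially o_def
proof (intro allI ballI impI, elim conjE)
  fix u :: "nat \<Rightarrow> real" and \<tau> assume "\<tau> \<in> {0..T}" "\<forall>n. u n \<in> {0..T}" "u \<longlonglongrightarrow> \<tau>"
  then show "(\<lambda>n. X (u n) (u n)) \<longlonglongrightarrow> X \<tau> \<tau>"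
    using X_jointly_tendsto[of \<tau> u u \<tau>] by blast
qed

lemma X_bounded: obtains S where "\<And>\<sigma> x. \<sigma> \<in> {0..T} \<Longrightarrow> x \<in> {0..T} \<Longrightarrow> norm (X \<sigma> x) \<le> S"
proof -
  have "continuous_on ({0..T} \<times> {0..T}) (\<lambda>p. X (fst p) (snd p))"
    unfolding continuous_on_sequentially o_def
  proof (intro allI ballI impI, elim conjE)
    fix u :: "nat \<Rightarrow> real \<times> real" and p
    assume "p \<in> {0..T} \<times> {0..T}" "\<forall>n. u n \<in> {0..T} \<times> {0..T}" "u \<longlonglongrightarrow> p"
    then show "(\<lambda>n. X (fst (u n)) (snd (u n))) \<longlonglongrightarrow> X (fst p) (snd p)"
      using X_jointly_tendsto[of "fst p" "\<lambda>n. fst (u n)" "\<lambda>n. snd (u n)" "snd p"]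
      by (simp add: mem_Times_iff tendsto_fst tendsto_snd)
  qed
  then have "compact ((\<lambda>p. X (fst p) (snd p)) ` ({0..T} \<times> {0..T}))"
    by (intro compact_continuous_image compact_Times) auto
  then obtain S where "\<forall>y\<in>(\<lambda>p. X (fst p) (snd p)) ` ({0..T} \<times> {0..T}). norm y \<le> S"
    using compact_imp_bounded bounded_iff by blast
  then show ?thesis by (intro that[of S]) force
qed

lemma kernel_shift_tendsto:
  assumes x: "x \<in> {0..T}" and \<tau>: "\<tau> \<in> {0..T}" and ne: "x \<noteq> \<tau>" and v: "\<And>n. v n \<in> {0..T}" "v \<longlonglongrightarrow> \<tau>"
  shows "(\<lambda>n. \<kappa> (x - v n)) \<longlonglongrightarrow> \<kappa> (x - \<tau>)"
proof (rule continuous_on_tendsto_compose[OF kernel_continuous])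
  show l: "(\<lambda>n. x - v n) \<longlonglongrightarrow> x - \<tau>" using v by (intro tendsto_intros)
  show "x - \<tau> \<in> {-T..T} - {0}" using x \<tau> ne by auto
  have "\<forall>\<^sub>F n in sequentially. x - v n \<noteq> 0"
    using ne by (intro tendsto_imp_eventually_ne[OF l]) simp
  then show "\<forall>\<^sub>F n in sequentially. x - v n \<in> {-T..T} - {0}"
    by (rule eventually_mono) (use x v(1) in \<open>simp, smt (verit)\<close>)
qed

end

text \<open>Reduces differentiability to sequences of difference quotients, the setting in which
  dominated convergence is available.\<close>

lemma has_vector_derivative_sequentiallyI:
  fixes f :: "real \<Rightarrow> 'a::real_normed_vector"
  assumes "\<And>s. (\<And>n. s n \<in> S) \<Longrightarrow> (\<And>n. s n \<noteq> x) \<Longrightarrow> s \<longlonglongrightarrow> x \<Longrightarrow>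
    (\<lambda>n. (1 / (s n - x)) *\<^sub>R (f (s n) - f x)) \<longlonglongrightarrow> D"
  shows "(f has_vector_derivative D) (at x within S)"
  unfolding has_vector_derivative_def has_derivative_iff_norm tendsto_at_iff_sequentially
proof (intro conjI allI impI)
  show "bounded_linear (\<lambda>h. h *\<^sub>R D)" by (rule bounded_linear_scaleR_left)
  fix s assume s: "\<forall>i. s i \<in> S - {x}" and lim: "s \<longlonglongrightarrow> x"
  have "(\<lambda>n. (1 / (s n - x)) *\<^sub>R (f (s n) - f x)) \<longlonglongrightarrow> D"
    using s lim by (intro assms) auto
  then have "(\<lambda>n. norm ((1 / (s n - x)) *\<^sub>R (f (s n) - f x) - D)) \<longlonglongrightarrow> 0"
    by (simp add: tendsto_norm_zero_iff LIM_zero_iff)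
  moreover have "norm ((1 / (s n - x)) *\<^sub>R (f (s n) - f x) - D)
      = norm (f (s n) - f x - (s n - x) *\<^sub>R D) / norm (s n - x)" for n
  proof -
    have "(1 / (s n - x)) *\<^sub>R (f (s n) - f x) - D = (1 / (s n - x)) *\<^sub>R (f (s n) - f x - (s n - x) *\<^sub>R D)"
      using s by (simp add: scaleR_diff_right)
    then show ?thesis by simp
  qed
  ultimately show "((\<lambda>y. norm (f y - f x - (y - x) *\<^sub>R D) / norm (y - x)) \<circ> s) \<longlonglongrightarrow> 0"
    by (simp add: o_def)
qed

section \<open>Differentiation with respect to the length of the interval\<close>

context conv_family
begin

text \<open>The error \<open>Q n\<close> solves the same kind of integral equation, with right-hand
  side \<open>R n x - \<kappa> (x - \<tau>) ** X \<tau> \<tau>\<close>. This tends to 0 in L1, and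
  the a priori bound passes the convergence on to \<open>Q n\<close>. The equation for
  \<open>W\<close> is asked only below \<tau>, because at \<tau> the kernel would be evaluated at
  its jump.\<close>

lemma difference_quotient_tendsto:
  assumes \<tau>: "\<tau> \<in> {0..T}" and W: "W absolutely_integrable_on {0..\<tau>}"
    and W_eq: "\<And>x. x \<in> {0..<\<tau>} \<Longrightarrow> W x = \<kappa> (x - \<tau>) + mconv \<kappa> \<tau> W x"
    and s: "\<And>n. s n \<in> {0..T}" "\<And>n. s n \<noteq> \<tau>" and lim: "s \<longlonglongrightarrow> \<tau>"
  shows "(\<lambda>n. integral {0..\<tau>} (\<lambda>x. norm ((1 / (s n - \<tau>)) *\<^sub>R (X (s n) x - X \<tau> x) - W x ** X \<tau> \<tau>))) \<longlonglongrightarrow> 0"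
proof -
  let ?A = "X \<tau> \<tau>"
  define R where "R n x = (1 / (s n - \<tau>)) *\<^sub>R incr \<tau> (s n) x" for n x
  define Q where "Q n x = (1 / (s n - \<tau>)) *\<^sub>R (X (s n) x - X \<tau> x) - W x ** ?A" for n x
  obtain S where S: "\<And>\<sigma> x. \<sigma> \<in> {0..T} \<Longrightarrow> x \<in> {0..T} \<Longrightarrow> norm (X \<sigma> x) \<le> S"
    using X_bounded by blast
  have Dint: "(\<lambda>x. (1 / (s n - \<tau>)) *\<^sub>R (X (s n) x - X \<tau> x)) absolutely_integrable_on {0..\<tau>}" for n
    using \<tau> s(1)[of n]
    by (intro absolutely_integrable_scaleR_left set_integral_diff X_absolutely_integrable) auto
  have WA: "(\<lambda>x. W x ** ?A) absolutely_integrable_on {0..\<tau>}"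
    using absolutely_integrable_linear[OF W mm.bounded_linear_left[of ?A]] by (simp add: o_def)
  have Qint: "Q n absolutely_integrable_on {0..\<tau>}" for n
    unfolding Q_def using Dint WA by (rule set_integral_diff)
  \<comment> \<open>Away from \<open>x = \<tau>\<close> the kernel is continuous at the relevant
    argument, so the mean over the shrinking interval tends to the value of the integrand at
    \<tau>.\<close>
  have R_lim: "(\<lambda>n. R n x) \<longlonglongrightarrow> \<kappa> (x - \<tau>) ** ?A" if x: "x \<in> {0..T}" "x \<noteq> \<tau>" for x
    unfolding R_def incr_def mconv_def
  proof (rule average_tendsto[OF \<tau> s lim])
    show "(\<lambda>v. \<kappa> (x - v) ** X (s n) v) integrable_on {0..T}" for n
      by (intro conv_integrable X_absolutely_integrable s order_refl)
    show "(\<lambda>n. \<kappa> (x - v n) ** X (s n) (v n)) \<longlonglongrightarrow> \<kappa> (x - \<tau>) ** ?A"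
      if "\<And>n. v n \<in> {0..T}" "v \<longlonglongrightarrow> \<tau>" for v
      by (rule mm.tendsto[OF kernel_shift_tendsto[OF x(1) \<tau> x(2) that] X_jointly_tendsto[OF \<tau> s(1) lim that \<tau>]])
  qed
  have R_bound: "norm (R n x) \<le> N * S" for n x
    using norm_incr_le[OF \<tau> s(1)[of n] S[OF s(1)[of n]], of x] s(2)[of n]
    by (simp add: R_def divide_le_eq)
  have R_int: "R n absolutely_integrable_on {0..\<tau>}" for n
    unfolding R_def
    by (intro absolutely_integrable_continuous_real continuous_intros
        continuous_on_subset[OF continuous_on_incr[OF \<tau> s(1)]]) (use \<tau> in auto)
  have \<kappa>_int: "(\<lambda>x. \<kappa> (x - \<tau>) ** ?A) absolutely_integrable_on {0..\<tau>}"
    using absolutely_integrable_linear[OF kernel_integrable mm.bounded_linear_left[of ?A]] by (simp add: o_def)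
  \<comment> \<open>At \<open>x = \<tau>\<close> the limit may fail because of the jump; a single
    point does not affect the integral.\<close>
  define r where "r n x = (if x = \<tau> then 0 else norm (R n x - \<kappa> (x - \<tau>) ** ?A))" for n x
  have r_int: "r n integrable_on {0..\<tau>}" for n
  proof (rule integrable_spike[of _ _ "{\<tau>}"])
    show "(\<lambda>x. norm (R n x - \<kappa> (x - \<tau>) ** ?A)) integrable_on {0..\<tau>}"
      using set_integral_diff(1)[OF R_int \<kappa>_int] by (simp add: absolutely_integrable_on_def)
  qed (auto simp: r_def)
  have "(\<lambda>n. integral {0..\<tau>} (r n)) \<longlonglongrightarrow> integral {0..\<tau>} (\<lambda>x. 0 :: real)"
  proof (rule dominated_convergence)
    show "(\<lambda>x. N * S + N * norm ?A) integrable_on {0..\<tau>}" by (rule integrable_const_ivl)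
    have S0: "0 \<le> N * S" using R_bound[of 0 0] by (meson norm_ge_zero order_trans)
    show "norm (r n x) \<le> N * S + N * norm ?A" for n x
      using norm_triangle_ineq4[of "R n x" "\<kappa> (x - \<tau>) ** ?A"] R_bound[of n x]
        kernel_bound[of "x - \<tau>" ?A] S0 N_pos by (simp add: r_def)
    show "(\<lambda>n. r n x) \<longlonglongrightarrow> 0" if "x \<in> {0..\<tau>}" for x
      using R_lim[of x] that \<tau>
      by (cases "x = \<tau>") (simp_all add: r_def tendsto_norm_zero_iff LIM_zero_iff)
  qed (rule r_int)
  then have r_lim: "(\<lambda>n. integral {0..\<tau>} (r n)) \<longlonglongrightarrow> 0" by simp
  \<comment> \<open>Linearity combines the increment equation, divided by
    \<open>s n - \<tau>\<close>, with the equation for \<open>W\<close> multiplied on the right by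
    the constant matrix \<open>X \<tau> \<tau>\<close>.\<close>
  have Q_eq: "Q n x - mconv \<kappa> \<tau> (Q n) x = R n x - \<kappa> (x - \<tau>) ** ?A" if x: "x \<in> {0..<\<tau>}" for n x
  proof -
    have xT: "x \<in> {0..T}" using x \<tau> by auto
    have "mconv \<kappa> \<tau> (Q n) x = (1 / (s n - \<tau>)) *\<^sub>R mconv \<kappa> \<tau> (\<lambda>v. X (s n) v - X \<tau> v) x - mconv \<kappa> \<tau> W x ** ?A"
      unfolding Q_def conv_diff[OF Dint WA] conv_scaleR conv_mult_right[OF W] ..
    then have "Q n x - mconv \<kappa> \<tau> (Q n) x = (1 / (s n - \<tau>)) *\<^sub>R
        (X (s n) x - X \<tau> x - mconv \<kappa> \<tau> (\<lambda>v. X (s n) v - X \<tau> v) x) - (W x - mconv \<kappa> \<tau> W x) ** ?A"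
      by (simp add: Q_def scaleR_diff_right mm.diff_left)
    then show ?thesis
      using W_eq[OF x] by (simp add: increment_equation[OF \<tau> s(1) xT] R_def)
  qed
  obtain C where C: "\<And>f. f absolutely_integrable_on {0..\<tau>} \<Longrightarrow>
      integral {0..\<tau>} (\<lambda>x. norm (f x)) \<le> C * integral {0..\<tau>} (\<lambda>x. norm (f x - mconv \<kappa> \<tau> f x))"
    using a_priori[OF \<tau>] unfolding a_priori_bound_def by blast
  have "norm (integral {0..\<tau>} (\<lambda>x. norm (Q n x))) \<le> C * integral {0..\<tau>} (r n)" for n
  proof -
    have "integral {0..\<tau>} (\<lambda>x. norm (Q n x - mconv \<kappa> \<tau> (Q n) x)) = integral {0..\<tau>} (r n)"
      by (rule integral_spike[of "{\<tau>}"]) (auto simp: r_def Q_eq)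
    moreover have "0 \<le> integral {0..\<tau>} (\<lambda>x. norm (Q n x))"
      using Qint[of n] by (intro integral_nonneg) (auto simp: absolutely_integrable_on_def)
    ultimately show ?thesis using C[OF Qint[of n]] by simp
  qed
  moreover have "(\<lambda>n. C * integral {0..\<tau>} (r n)) \<longlonglongrightarrow> 0"
    using tendsto_mult[OF tendsto_const[of C] r_lim] by simp
  ultimately have "(\<lambda>n. integral {0..\<tau>} (\<lambda>x. norm (Q n x))) \<longlonglongrightarrow> 0"
    by (intro Lim_null_comparison[of "\<lambda>n. integral {0..\<tau>} (\<lambda>x. norm (Q n x))"] always_eventually) auto
  then show ?thesis by (simp add: Q_def)
qed

text \<open>A Leibniz rule: the moving endpoint contributes
  \<open>\<phi> \<tau> ** X \<tau> \<tau>\<close>, and the change of the solution contributes the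
  integral of \<open>\<phi>\<close> against its L1 derivative \<open>W x ** X \<tau> \<tau>\<close>.
  A bounded weight preserves L1 convergence.\<close>

lemma has_vector_derivative_integral_X:
  fixes \<phi> :: "real \<Rightarrow> complex^'r^'r"
  assumes \<tau>: "\<tau> \<in> {0..T}" and W: "W absolutely_integrable_on {0..\<tau>}"
    and W_eq: "\<And>x. x \<in> {0..<\<tau>} \<Longrightarrow> W x = \<kappa> (x - \<tau>) + mconv \<kappa> \<tau> W x"
    and \<phi>: "continuous_on {0..T} \<phi>"
  shows "((\<lambda>\<sigma>. integral {0..\<sigma>} (\<lambda>x. \<phi> x ** X \<sigma> x)) has_vector_derivative
      (\<phi> \<tau> + integral {0..\<tau>} (\<lambda>x. \<phi> x ** W x)) ** X \<tau> \<tau>) (at \<tau> within {0..T})"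
proof (rule has_vector_derivative_sequentiallyI)
  fix s assume s: "\<And>n. s n \<in> {0..T}" "\<And>n. s n \<noteq> \<tau>" and lim: "s \<longlonglongrightarrow> \<tau>"
  let ?A = "X \<tau> \<tau>"
  define Q where "Q n x = (1 / (s n - \<tau>)) *\<^sub>R (X (s n) x - X \<tau> x) - W x ** ?A" for n x
  have \<tau>T: "\<tau> \<le> T" using \<tau> by auto
  have \<phi>X: "(\<lambda>x. \<phi> x ** X \<sigma> x) integrable_on {0..\<rho>}" if "\<sigma> \<in> {0..T}" "\<rho> \<le> T" for \<sigma> \<rho>
    using continuous_mult_integrable[OF \<phi> that(2) X_absolutely_integrable[OF that]]
    by (simp add: absolutely_integrable_on_def)
  have Q_lim: "(\<lambda>n. integral {0..\<tau>} (\<lambda>x. norm (Q n x))) \<longlonglongrightarrow> 0"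
    unfolding Q_def by (rule difference_quotient_tendsto[OF \<tau> W W_eq s lim])
  have WA: "(\<lambda>x. W x ** ?A) absolutely_integrable_on {0..\<tau>}"
    using absolutely_integrable_linear[OF W mm.bounded_linear_left[of ?A]] by (simp add: o_def)
  have Qint: "Q n absolutely_integrable_on {0..\<tau>}" for n
    unfolding Q_def using \<tau> s(1)[of n]
    by (intro absolutely_integrable_scaleR_left set_integral_diff X_absolutely_integrable WA) auto
  have \<phi>Q: "(\<lambda>x. \<phi> x ** Q n x) integrable_on {0..\<tau>}" for n
    using continuous_mult_integrable[OF \<phi> \<tau>T Qint[of n]] by (simp add: absolutely_integrable_on_def)
  have \<phi>W: "(\<lambda>x. \<phi> x ** W x) integrable_on {0..\<tau>}"
    using continuous_mult_integrable[OF \<phi> \<tau>T W] by (simp add: absolutely_integrable_on_def)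
  have boundary: "(\<lambda>n. (1 / (s n - \<tau>)) *\<^sub>R (integral {0..s n} (\<lambda>x. \<phi> x ** X (s n) x)
      - integral {0..\<tau>} (\<lambda>x. \<phi> x ** X (s n) x))) \<longlonglongrightarrow> \<phi> \<tau> ** ?A"
  proof (rule average_tendsto[OF \<tau> s lim])
    show "(\<lambda>x. \<phi> x ** X (s n) x) integrable_on {0..T}" for n using \<phi>X s(1) by blast
    show "(\<lambda>n. \<phi> (v n) ** X (s n) (v n)) \<longlonglongrightarrow> \<phi> \<tau> ** ?A"
      if "\<And>n. v n \<in> {0..T}" "v \<longlonglongrightarrow> \<tau>" for v
      using continuous_on_tendsto_compose[OF \<phi> that(2) \<tau>] that
      by (intro mm.tendsto X_jointly_tendsto[OF \<tau> s(1) lim that \<tau>]) simp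
  qed
  obtain K where K: "\<And>x. x \<in> {0..\<tau>} \<Longrightarrow> norm (\<phi> x) \<le> K"
  proof -
    have "bounded (\<phi> ` {0..T})"
      by (intro compact_imp_bounded compact_continuous_image \<phi>) auto
    then obtain K where "\<forall>y\<in>\<phi> ` {0..T}. norm y \<le> K" unfolding bounded_iff by blast
    then show ?thesis using \<tau> by (intro that[of K]) auto
  qed
  obtain c where c: "0 < c" "\<And>(A :: complex^'r^'r) (B :: complex^'r^'r). norm (A ** B) \<le> norm A * norm B * c"
    using mm.pos_bounded by blast
  have "norm (integral {0..\<tau>} (\<lambda>x. \<phi> x ** Q n x)) \<le> K * c * integral {0..\<tau>} (\<lambda>x. norm (Q n x))" for n
  proof -
    have "norm (integral {0..\<tau>} (\<lambda>x. \<phi> x ** Q n x)) \<le> integral {0..\<tau>} (\<lambda>x. K * c * norm (Q n x))"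
    proof (rule integral_norm_bound_integral[OF \<phi>Q])
      show "(\<lambda>x. K * c * norm (Q n x)) integrable_on {0..\<tau>}"
        using Qint[of n] by (auto simp: absolutely_integrable_on_def intro: integrable_on_mult_right)
      fix x assume "x \<in> {0..\<tau>}"
      then have "norm (\<phi> x) * (c * norm (Q n x)) \<le> K * (c * norm (Q n x))"
        using K c(1) by (intro mult_right_mono) auto
      then show "norm (\<phi> x ** Q n x) \<le> K * c * norm (Q n x)"
        using c(2)[of "\<phi> x" "Q n x"] by (simp add: mult_ac)
    qed
    then show ?thesis by simp
  qed
  moreover have "(\<lambda>n. K * c * integral {0..\<tau>} (\<lambda>x. norm (Q n x))) \<longlonglongrightarrow> 0"
    using tendsto_mult[OF tendsto_const[of "K * c"] Q_lim] by simp
  ultimately have interior: "(\<lambda>n. integral {0..\<tau>} (\<lambda>x. \<phi> x ** Q n x)) \<longlonglongrightarrow> 0"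
    by (intro Lim_null_comparison[of "\<lambda>n. integral {0..\<tau>} (\<lambda>x. \<phi> x ** Q n x)"] always_eventually) auto
  \<comment> \<open>The quotient is the mean over the added or removed interval, plus the weighted
    error \<open>Q n\<close>, plus the expected interior term.\<close>
  have split: "(1 / (s n - \<tau>)) *\<^sub>R (integral {0..s n} (\<lambda>x. \<phi> x ** X (s n) x) - integral {0..\<tau>} (\<lambda>x. \<phi> x ** X \<tau> x))
    = (1 / (s n - \<tau>)) *\<^sub>R (integral {0..s n} (\<lambda>x. \<phi> x ** X (s n) x) - integral {0..\<tau>} (\<lambda>x. \<phi> x ** X (s n) x))
      + integral {0..\<tau>} (\<lambda>x. \<phi> x ** Q n x) + integral {0..\<tau>} (\<lambda>x. \<phi> x ** W x) ** ?A" for n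
  proof -
    have "integral {0..\<tau>} (\<lambda>x. \<phi> x ** Q n x) + integral {0..\<tau>} (\<lambda>x. \<phi> x ** W x ** ?A)
        = integral {0..\<tau>} (\<lambda>x. (1 / (s n - \<tau>)) *\<^sub>R (\<phi> x ** X (s n) x - \<phi> x ** X \<tau> x))"
    proof (subst integral_add[symmetric])
      show "(\<lambda>x. \<phi> x ** W x ** ?A) integrable_on {0..\<tau>}"
        using integrable_linear[OF \<phi>W mm.bounded_linear_left[of ?A]] by (simp add: o_def)
      show "integral {0..\<tau>} (\<lambda>x. \<phi> x ** Q n x + \<phi> x ** W x ** ?A)
        = integral {0..\<tau>} (\<lambda>x. (1 / (s n - \<tau>)) *\<^sub>R (\<phi> x ** X (s n) x - \<phi> x ** X \<tau> x))"
        by (intro integral_cong) (simp add: Q_def mm.diff_right mm.scaleR_right matrix_mul_assoc)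
    qed (rule \<phi>Q)
    also have "\<dots> = (1 / (s n - \<tau>)) *\<^sub>R (integral {0..\<tau>} (\<lambda>x. \<phi> x ** X (s n) x) - integral {0..\<tau>} (\<lambda>x. \<phi> x ** X \<tau> x))"
      by (simp add: integral_diff \<phi>X s(1) \<tau> \<tau>T del: atLeastAtMost_iff)
    also have "integral {0..\<tau>} (\<lambda>x. \<phi> x ** W x ** ?A) = integral {0..\<tau>} (\<lambda>x. \<phi> x ** W x) ** ?A"
      using integral_linear[OF \<phi>W mm.bounded_linear_left[of ?A]] by (simp add: o_def)
    finally show ?thesis by (simp add: scaleR_diff_right algebra_simps)
  qed
  show "(\<lambda>n. (1 / (s n - \<tau>)) *\<^sub>R (integral {0..s n} (\<lambda>x. \<phi> x ** X (s n) x) - integral {0..\<tau>} (\<lambda>x. \<phi> x ** X \<tau> x)))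
      \<longlonglongrightarrow> (\<phi> \<tau> + integral {0..\<tau>} (\<lambda>x. \<phi> x ** W x)) ** ?A"
    unfolding split
    using tendsto_add[OF tendsto_add[OF boundary interior] tendsto_const[of "integral {0..\<tau>} (\<lambda>x. \<phi> x ** W x) ** ?A"]]
    by (simp add: mm.add_left)
qed

end

section \<open>Reflection, invertibility and adjoints\<close>

lemma has_integral_reflect_Icc:
  fixes h :: "real \<Rightarrow> 'a::banach"
  assumes "(h has_integral I) {0..\<tau>}"
  shows "((\<lambda>x. h (\<tau> - x)) has_integral I) {0..\<tau>}"
proof -
  have "((\<lambda>x. h (-x)) has_integral I) {-\<tau>..0}"
    using assms has_integral_reflect_real[of h I \<tau> 0] by simp
  then have "(((\<lambda>x. h (-x)) \<circ> (+) (-\<tau>)) has_integral I) {0..\<tau>}"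
    by (subst has_integral_shift_Icc_real) simp
  then show ?thesis by (simp add: o_def)
qed

lemma integrable_reflect_Icc:
  fixes h :: "real \<Rightarrow> 'a::banach"
  shows "h integrable_on {0..\<tau>} \<Longrightarrow> (\<lambda>x. h (\<tau> - x)) integrable_on {0..\<tau>}"
  using has_integral_reflect_Icc by (auto simp: integrable_on_def)

lemma integral_reflect_Icc:
  fixes h :: "real \<Rightarrow> 'a::banach"
  shows "integral {0..\<tau>} (\<lambda>x. h (\<tau> - x)) = integral {0..\<tau>} h"
proof (cases "h integrable_on {0..\<tau>}")
  case True
  then show ?thesis using has_integral_reflect_Icc integral_unique by blast
next
  \<comment> \<open>Reflection is an involution, so it preserves non-integrability too, and both
    integrals then have the default value 0.\<close>
  case False
  then have "\<not> (\<lambda>x. h (\<tau> - x)) integrable_on {0..\<tau>}"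
    using integrable_reflect_Icc[of "\<lambda>x. h (\<tau> - x)" \<tau>] by auto
  with False show ?thesis by (simp add: not_integrable_integral)
qed

lemma absolutely_integrable_reflect_Icc:
  fixes h :: "real \<Rightarrow> 'a::euclidean_space"
  shows "h absolutely_integrable_on {0..\<tau>} \<Longrightarrow> (\<lambda>x. h (\<tau> - x)) absolutely_integrable_on {0..\<tau>}"
  using integrable_reflect_Icc[of h \<tau>] integrable_reflect_Icc[of "\<lambda>x. norm (h x)" \<tau>]
  by (simp add: absolutely_integrable_on_def)

text \<open>Substituting \<tau> - v for v shows that reflection of [0,\<tau>] conjugates the
  operators with kernels \<kappa>(x) and \<kappa>(-x).\<close>

lemma mconv_reflect: "mconv (\<lambda>x. \<kappa> (- x)) \<tau> f x = mconv \<kappa> \<tau> (\<lambda>v. f (\<tau> - v)) (\<tau> - x)"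
  unfolding mconv_def
  using integral_reflect_Icc[of \<tau> "\<lambda>v. \<kappa> (v - x) ** f v"] by (simp add: algebra_simps)

lemma a_priori_bound_reflect:
  assumes "a_priori_bound \<kappa> \<tau>"
  shows "a_priori_bound (\<lambda>x. \<kappa> (- x)) \<tau>"
proof -
  obtain C where C: "\<And>f. f absolutely_integrable_on {0..\<tau>} \<Longrightarrow>
     integral {0..\<tau>} (\<lambda>x. norm (f x)) \<le> C * integral {0..\<tau>} (\<lambda>x. norm (f x - mconv \<kappa> \<tau> f x))"
    using assms unfolding a_priori_bound_def by blast
  have "integral {0..\<tau>} (\<lambda>x. norm (f x)) \<le>
      C * integral {0..\<tau>} (\<lambda>x. norm (f x - mconv (\<lambda>x. \<kappa> (- x)) \<tau> f x))"
    if "f absolutely_integrable_on {0..\<tau>}" for f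
    using C[OF absolutely_integrable_reflect_Icc[OF that]]
      integral_reflect_Icc[of \<tau> "\<lambda>x. norm (f x)"]
      integral_reflect_Icc[of \<tau> "\<lambda>x. norm (f (\<tau> - x) - mconv \<kappa> \<tau> (\<lambda>v. f (\<tau> - v)) x)"]
    by (simp add: mconv_reflect)
  then show ?thesis unfolding a_priori_bound_def by blast
qed

text \<open>The constant is a bound for the inverse \<open>B\<close>: \<open>B (A f)\<close> equals
  \<open>f\<close> almost everywhere and so has the same norm. The maximum with 0 is taken because
  the definition of a bounded operator puts no sign on its constant.\<close>

lemma L1_invertible_a_priori:
  assumes "L1_invertible \<tau> A"
  obtains C where "0 \<le> C" "\<And>f. f \<in> L1 \<tau> \<Longrightarrow> L1_norm \<tau> f \<le> C * L1_norm \<tau> (A f)"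
proof -
  have A: "A f \<in> L1 \<tau>" if "f \<in> L1 \<tau>" for f
    using assms that unfolding L1_invertible_def L1_bounded_operator_def by simp
  obtain B where Bb: "L1_bounded_operator \<tau> B"
    and BA: "\<And>f. f \<in> L1 \<tau> \<Longrightarrow> L1_eq \<tau> (B (A f)) f"
    using assms unfolding L1_invertible_def by blast
  then obtain C where C: "\<And>f. f \<in> L1 \<tau> \<Longrightarrow> L1_norm \<tau> (B f) \<le> C * L1_norm \<tau> f"
    unfolding L1_bounded_operator_def by blast
  have B: "B f \<in> L1 \<tau>" if "f \<in> L1 \<tau>" for f
    using Bb that unfolding L1_bounded_operator_def by blast
  have L1_norm: "integrable (lebesgue_on {0..\<tau>}) (\<lambda>t. norm (f t))"
    "L1_norm \<tau> f = (LINT t|lebesgue_on {0..\<tau>}. norm (f t))" if "f \<in> L1 \<tau>" for f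
  proof -
    show 1: "integrable (lebesgue_on {0..\<tau>}) (\<lambda>t. norm (f t))"
      using that by (auto simp: L1_def set_integrable_def integrable_restrict_space)
    show "L1_norm \<tau> f = (LINT t|lebesgue_on {0..\<tau>}. norm (f t))"
      using lebesgue_integral_eq_integral[OF 1] by (simp add: L1_norm_def)
  qed
  have "L1_norm \<tau> f \<le> max C 0 * L1_norm \<tau> (A f)" if f: "f \<in> L1 \<tau>" for f
  proof -
    have "L1_norm \<tau> f = L1_norm \<tau> (B (A f))"
      unfolding L1_norm(2)[OF f] L1_norm(2)[OF B[OF A[OF f]]]
    proof (rule integral_cong_AE)
      show "AE t in lebesgue_on {0..\<tau>}. norm (f t) = norm (B (A f) t)"
        using BA[OF f] unfolding L1_eq_def by eventually_elim simp
    qed (use L1_norm(1) f A B in auto)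
    also have "\<dots> \<le> C * L1_norm \<tau> (A f)" by (rule C[OF A[OF f]])
    also have "\<dots> \<le> max C 0 * L1_norm \<tau> (A f)"
      using L1_norm[OF A[OF f]] by (intro mult_right_mono) auto
    finally show ?thesis .
  qed
  then show ?thesis by (intro that[of "max C 0"]) auto
qed

context bounded_kernel
begin

text \<open>The vector estimate is applied to each column of \<open>f\<close>; summing over the
  columns yields the factor \<open>CARD('r)\<close>. On the differences that occur, \<open>k\<close>
  and \<kappa> can disagree only at 0, which is one point of each integral.\<close>

lemma a_priori_bound_of_invertible:
  assumes inv: "L1_invertible \<tau> (conv_operator k \<tau>)" and \<tau>: "\<tau> \<le> T"
    and k: "\<And>x. x \<in> {-\<tau>..\<tau>} \<Longrightarrow> x \<noteq> 0 \<Longrightarrow> k x = \<kappa> x"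
  shows "a_priori_bound \<kappa> \<tau>"
proof -
  obtain C where C0: "0 \<le> C"
    and C: "\<And>f. f \<in> L1 \<tau> \<Longrightarrow> L1_norm \<tau> f \<le> C * L1_norm \<tau> (conv_operator k \<tau> f)"
    using L1_invertible_a_priori[OF inv] by blast
  have "integral {0..\<tau>} (\<lambda>x. norm (f x)) \<le>
      (real CARD('r) * C) * integral {0..\<tau>} (\<lambda>x. norm (f x - mconv \<kappa> \<tau> f x))"
    if f: "f absolutely_integrable_on {0..\<tau>}" for f :: "real \<Rightarrow> complex^'r^'r"
  proof -
    have col: "(\<lambda>x. column j (g x)) absolutely_integrable_on {0..\<tau>}"
      if "g absolutely_integrable_on {0..\<tau>}" for j and g :: "real \<Rightarrow> complex^'r^'r"
      using absolutely_integrable_linear[OF that bounded_linear_column] by (simp add: o_def)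
    have g: "(\<lambda>x. f x - mconv \<kappa> \<tau> f x) absolutely_integrable_on {0..\<tau>}"
      by (intro set_integral_diff f absolutely_integrable_continuous_real
          continuous_on_subset[OF continuous_on_conv[OF f \<tau>]]) (use \<tau> in auto)
    have op: "conv_operator k \<tau> (\<lambda>x. column j (f x)) t = column j (f t - mconv \<kappa> \<tau> f t)"
      if t: "t \<in> {0..\<tau>}" for j t
    proof -
      have "integral {0..\<tau>} (\<lambda>s. k (t - s) *v column j (f s)) =
          integral {0..\<tau>} (\<lambda>s. column j (\<kappa> (t - s) ** f s))"
        by (rule integral_spike[of "{t}"]) (use t in \<open>auto simp: column_matrix_mult k\<close>)
      also have "\<dots> = column j (mconv \<kappa> \<tau> f t)"
        using integral_linear[OF conv_integrable[OF f] bounded_linear_column]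
        by (simp add: o_def mconv_def)
      finally show ?thesis
        by (simp add: conv_operator_def linear_diff[OF bounded_linear.linear[OF bounded_linear_column]])
    qed
    have nf: "(\<lambda>x. norm (column j (f x))) integrable_on {0..\<tau>}" for j
      using col[OF f] by (simp add: absolutely_integrable_on_def)
    have "integral {0..\<tau>} (\<lambda>x. norm (f x)) \<le> integral {0..\<tau>} (\<lambda>x. \<Sum>j\<in>UNIV. norm (column j (f x)))"
      using f nf by (intro integral_le norm_le_sum_norm_column integrable_sum)
        (auto simp: absolutely_integrable_on_def)
    also have "\<dots> = (\<Sum>j\<in>UNIV. integral {0..\<tau>} (\<lambda>x. norm (column j (f x))))"
      using nf by (intro integral_sum) auto
    also have "\<dots> \<le> (\<Sum>j\<in>(UNIV :: 'r set). C * integral {0..\<tau>} (\<lambda>x. norm (f x - mconv \<kappa> \<tau> f x)))"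
    proof (rule sum_mono)
      fix j :: 'r
      have "integral {0..\<tau>} (\<lambda>x. norm (column j (f x))) \<le>
          C * integral {0..\<tau>} (\<lambda>x. norm (conv_operator k \<tau> (\<lambda>x. column j (f x)) x))"
        using C[of "\<lambda>x. column j (f x)"] col[OF f] by (simp add: L1_def L1_norm_def)
      also have "integral {0..\<tau>} (\<lambda>x. norm (conv_operator k \<tau> (\<lambda>x. column j (f x)) x)) =
          integral {0..\<tau>} (\<lambda>x. norm (column j (f x - mconv \<kappa> \<tau> f x)))"
        by (intro integral_cong) (simp add: op)
      also have "C * \<dots> \<le> C * integral {0..\<tau>} (\<lambda>x. norm (f x - mconv \<kappa> \<tau> f x))"
        using g col[OF g] by (intro mult_left_mono C0 integral_le norm_column_le)
          (auto simp: absolutely_integrable_on_def)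
      finally show "integral {0..\<tau>} (\<lambda>x. norm (column j (f x))) \<le>
          C * integral {0..\<tau>} (\<lambda>x. norm (f x - mconv \<kappa> \<tau> f x))" .
    qed
    finally show ?thesis by simp
  qed
  then show ?thesis unfolding a_priori_bound_def by blast
qed

text \<open>Fubini on the square, where the integrand is bounded and measurable. With hermitian
  \<kappa> this becomes the self-adjointness of the convolution operator.\<close>

lemma conv_swap:
  fixes f g :: "real \<Rightarrow> complex^'r^'r"
  assumes f: "continuous_on {0..\<tau>} f" and g: "continuous_on {0..\<tau>} g"
  shows "integral {0..\<tau>} (\<lambda>t. f t ** mconv \<kappa> \<tau> g t) =
    integral {0..\<tau>} (\<lambda>v. integral {0..\<tau>} (\<lambda>t. f t ** \<kappa> (t - v)) ** g v)"
    (is "?l = ?r")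
proof -
  let ?I = "indicator {0..\<tau>} :: real \<Rightarrow> real"
  \<comment> \<open>The indicators extend the integrand by 0 to the plane, so that Fubini for
    \<open>lborel\<close> can be used and the inner integrals are defined for every \<open>t\<close>
    and \<open>v\<close>.\<close>
  define H where "H t v = ?I t *\<^sub>R (?I v *\<^sub>R (f t ** (\<kappa> (t - v) ** g v)))" for t v
  have gi: "g absolutely_integrable_on {0..\<tau>}" by (rule absolutely_integrable_continuous_real[OF g])
  have fi: "f absolutely_integrable_on {0..\<tau>}" by (rule absolutely_integrable_continuous_real[OF f])
  have meas_mult: "(\<lambda>p. u p ** w p) \<in> borel_measurable M"
    if "u \<in> borel_measurable M" "w \<in> borel_measurable M"
    for M and u w :: "real \<times> real \<Rightarrow> complex^'r^'r"
    by (rule borel_measurable_continuous_Pair[OF that])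
      (intro mm.continuous_on continuous_on_fst continuous_on_snd continuous_on_id)
  have F: "(\<lambda>t. ?I t *\<^sub>R f t) \<in> borel_measurable lborel" and G: "(\<lambda>t. ?I t *\<^sub>R g t) \<in> borel_measurable lborel"
    using f g by (auto intro!: borel_measurable_continuous_on_indicator)
  have K: "(\<lambda>p. \<kappa> (fst p - snd p)) \<in> borel_measurable (lborel \<Otimes>\<^sub>M lborel)"
    by (rule measurable_compose[OF _ kernel_measurable]) simp
  have "(\<lambda>p. (?I (fst p) *\<^sub>R f (fst p)) ** (\<kappa> (fst p - snd p) ** (?I (snd p) *\<^sub>R g (snd p))))
      \<in> borel_measurable (lborel \<Otimes>\<^sub>M lborel)"
    by (rule meas_mult[OF measurable_compose[OF measurable_fst F]
          meas_mult[OF K measurable_compose[OF measurable_snd G]]])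
  also have "(\<lambda>p. (?I (fst p) *\<^sub>R f (fst p)) ** (\<kappa> (fst p - snd p) ** (?I (snd p) *\<^sub>R g (snd p))))
      = (\<lambda>(t, v). H t v)"
    by (auto simp: H_def mm.scaleR_left mm.scaleR_right fun_eq_iff)
  finally have Hm [measurable]: "(\<lambda>(t, v). H t v) \<in> borel_measurable (lborel \<Otimes>\<^sub>M lborel)" .
  have Hm1: "(\<lambda>v. H t v) \<in> borel_measurable lborel" and Hm2: "(\<lambda>v. H v t) \<in> borel_measurable lborel" for t
    by measurable
  have bdd: "\<exists>K. \<forall>x\<in>{0..\<tau>}. norm (h x) \<le> K" if "continuous_on {0..\<tau>} h" for h :: "real \<Rightarrow> complex^'r^'r"
    using compact_imp_bounded[OF compact_continuous_image[OF that]] by (auto simp: bounded_iff)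
  obtain Kf where Kf: "\<And>x. x \<in> {0..\<tau>} \<Longrightarrow> norm (f x) \<le> Kf" using bdd[OF f] by blast
  obtain Kg where Kg: "\<And>x. x \<in> {0..\<tau>} \<Longrightarrow> norm (g x) \<le> Kg" using bdd[OF g] by blast
  obtain c where c: "0 < c" "\<And>(A :: complex^'r^'r) (B :: complex^'r^'r). norm (A ** B) \<le> norm A * norm B * c"
    using mm.pos_bounded by blast
  have bound: "norm (H t v) \<le> Kf * (N * Kg) * c" if "t \<in> {0..\<tau>}" "v \<in> {0..\<tau>}" for t v
  proof -
    have "norm (\<kappa> (t - v) ** g v) \<le> N * Kg"
      using kernel_bound[of "t - v" "g v"] Kg[OF that(2)] N_pos by (smt (verit) mult_left_mono)
    then have "norm (f t) * norm (\<kappa> (t - v) ** g v) \<le> Kf * (N * Kg)"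
      using Kf[OF that(1)] by (intro mult_mono) (auto intro: order_trans[OF norm_ge_zero])
    then have "norm (f t) * norm (\<kappa> (t - v) ** g v) * c \<le> Kf * (N * Kg) * c"
      using c(1) by (intro mult_right_mono) auto
    with c(2)[of "f t" "\<kappa> (t - v) ** g v"] that show ?thesis by (simp add: H_def)
  qed
  have zero: "H t v = 0" if "t \<notin> {0..\<tau>} \<or> v \<notin> {0..\<tau>}" for t v
    using that by (auto simp: H_def)
  have Hint: "integrable (lborel \<Otimes>\<^sub>M lborel) (\<lambda>(t, v). H t v)"
  proof (rule integrableI_bounded_set[where A = "{0..\<tau>} \<times> {0..\<tau>}" and B = "Kf * (N * Kg) * c"])
    show "emeasure (lborel \<Otimes>\<^sub>M lborel) ({0..\<tau>} \<times> {0..\<tau>}) < \<infinity>"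
      unfolding lborel_prod by (intro emeasure_bounded_finite bounded_Times) auto
  qed (auto intro!: always_eventually bound zero Hm)
  have H1: "integrable lborel (\<lambda>v. H t v)" and H2: "integrable lborel (\<lambda>v. H v t)" for t
  proof -
    show "integrable lborel (\<lambda>v. H t v)"
    proof (cases "t \<in> {0..\<tau>}")
      case True
      then show ?thesis
        by (intro integrableI_bounded_set[where A = "{0..\<tau>}" and B = "Kf * (N * Kg) * c"] Hm1)
          (auto intro!: always_eventually bound zero emeasure_bounded_finite)
    qed (simp add: zero)
    show "integrable lborel (\<lambda>v. H v t)"
    proof (cases "t \<in> {0..\<tau>}")
      case True
      then show ?thesis
        by (intro integrableI_bounded_set[where A = "{0..\<tau>}" and B = "Kf * (N * Kg) * c"] Hm2)
          (auto intro!: always_eventually bound zero emeasure_bounded_finite)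
    qed (simp add: zero)
  qed
  have inner1: "(LINT v|lborel. H t v) = ?I t *\<^sub>R (f t ** mconv \<kappa> \<tau> g t)" for t
  proof -
    have H': "H t = (\<lambda>v. ?I v *\<^sub>R (?I t *\<^sub>R (f t ** (\<kappa> (t - v) ** g v))))"
      by (simp add: H_def fun_eq_iff scaleR_left_commute)
    have "set_integrable lborel {0..\<tau>} (\<lambda>v. ?I t *\<^sub>R (f t ** (\<kappa> (t - v) ** g v)))"
      using H1[of t] unfolding set_integrable_def H' .
    from set_borel_integral_eq_integral(2)[OF this]
    have "(LINT v|lborel. H t v) = integral {0..\<tau>} (\<lambda>v. ?I t *\<^sub>R (f t ** (\<kappa> (t - v) ** g v)))"
      unfolding set_lebesgue_integral_def H' .
    also have "\<dots> = ?I t *\<^sub>R (f t ** mconv \<kappa> \<tau> g t)"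
      using integral_linear[OF conv_integrable[OF gi, of t] mm.bounded_linear_right[of "f t"]]
      by (simp add: o_def mconv_def)
    finally show ?thesis .
  qed
  have inner2: "(LINT t|lborel. H t v) = ?I v *\<^sub>R (integral {0..\<tau>} (\<lambda>t. f t ** \<kappa> (t - v)) ** g v)" for v
  proof -
    have "set_integrable lborel {0..\<tau>} (\<lambda>t. ?I v *\<^sub>R (f t ** (\<kappa> (t - v) ** g v)))"
      using H2[of v] unfolding set_integrable_def H_def .
    from set_borel_integral_eq_integral(2)[OF this]
    have "(LINT t|lborel. H t v) = integral {0..\<tau>} (\<lambda>t. ?I v *\<^sub>R (f t ** (\<kappa> (t - v) ** g v)))"
      unfolding set_lebesgue_integral_def H_def .
    also have "\<dots> = ?I v *\<^sub>R (integral {0..\<tau>} (\<lambda>t. f t ** \<kappa> (t - v)) ** g v)"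
    proof -
      have "(\<lambda>t. f t ** \<kappa> (t - v)) integrable_on {0..\<tau>}"
        using continuous_mult_integrable[OF f order_refl kernel_integrable]
        by (simp add: absolutely_integrable_on_def)
      from integral_linear[OF this mm.bounded_linear_left[of "g v"]]
      show ?thesis by (simp add: o_def matrix_mul_assoc)
    qed
    finally show ?thesis .
  qed
  have "?l = (LINT t|lborel. (LINT v|lborel. H t v))"
  proof -
    have "set_integrable lborel {0..\<tau>} (\<lambda>t. f t ** mconv \<kappa> \<tau> g t)"
      using lborel_pair.integrable_fst'[OF Hint] by (simp add: set_integrable_def inner1)
    from set_borel_integral_eq_integral(2)[OF this] show ?thesis
      by (simp add: set_lebesgue_integral_def inner1)
  qed
  also have "\<dots> = (LINT v|lborel. (LINT t|lborel. H t v))"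
    using lborel_pair.Fubini_integral[OF Hint] by simp
  also have "\<dots> = ?r"
  proof -
    have "set_integrable lborel {0..\<tau>} (\<lambda>v. integral {0..\<tau>} (\<lambda>t. f t ** \<kappa> (t - v)) ** g v)"
      using lborel_pair.integrable_fst'[OF lborel_pair.integrable_product_swap[OF Hint]]
      by (simp add: set_integrable_def inner2)
    from set_borel_integral_eq_integral(2)[OF this] show ?thesis
      by (simp add: set_lebesgue_integral_def inner2)
  qed
  finally show ?thesis .
qed

end

text \<open>Both convolution values are expressed through the pairing of \<open>V\<close> and
  \<open>X\<close>: the kernel section seen from \<tau> is replaced using the equation for
  \<open>V\<close>, the section seen from 0 using the equation for \<open>X\<close>. The two
  pairings agree by self-adjointness. Each equation leaves out the one endpoint where the kernel has
  argument 0.\<close>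

lemma (in bounded_kernel) resolvent_adjoint:
  assumes herm: "\<And>x. \<kappa> (- x) = conj_transpose (\<kappa> x)" and \<tau>: "0 < \<tau>" "\<tau> \<le> T"
    and X: "continuous_on {0..\<tau>} X" and V: "continuous_on {0..\<tau>} V"
    and X_eq: "\<And>t. t \<in> {0<..\<tau>} \<Longrightarrow> X t = \<kappa> t + mconv \<kappa> \<tau> X t"
    and V_eq: "\<And>t. t \<in> {0..<\<tau>} \<Longrightarrow> V t = \<kappa> (t - \<tau>) + mconv \<kappa> \<tau> V t"
  shows "conj_transpose (V 0) = X \<tau>"
proof -
  note ct = bounded_linear_conj_transpose
  have Xi: "X absolutely_integrable_on {0..\<tau>}" and Vi: "V absolutely_integrable_on {0..\<tau>}"
    using X V by (auto intro: absolutely_integrable_continuous_real)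
  have cX: "continuous_on {0..\<tau>} (mconv \<kappa> \<tau> X)" and cV: "continuous_on {0..\<tau>} (mconv \<kappa> \<tau> V)"
    using continuous_on_conv[OF Xi \<tau>(2)] continuous_on_conv[OF Vi \<tau>(2)] \<tau>
    by (auto elim: continuous_on_subset)
  have V': "continuous_on {0..\<tau>} (\<lambda>t. conj_transpose (V t))"
    by (rule bounded_linear.continuous_on[OF ct V])
  have cV': "continuous_on {0..\<tau>} (\<lambda>t. conj_transpose (mconv \<kappa> \<tau> V t))"
    by (rule bounded_linear.continuous_on[OF ct cV])
  have herm': "conj_transpose (\<kappa> (a - b)) = \<kappa> (b - a)" for a b
    using herm[of "a - b"] by simp
  have conj_conv: "conj_transpose (mconv \<kappa> \<tau> V t) = integral {0..\<tau>} (\<lambda>v. conj_transpose (V v) ** \<kappa> (v - t))" for t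
    using integral_linear[OF conv_integrable[OF Vi, of t] ct]
    by (simp add: o_def mconv_def conj_transpose_mult herm')
  \<comment> \<open>The adjoint of the equation for \<open>V\<close> eliminates
    \<open>\<kappa> (\<tau> - v)\<close>, except at the null point
    \<open>v = \<tau>\<close>.\<close>
  have "mconv \<kappa> \<tau> X \<tau> = integral {0..\<tau>} (\<lambda>v. conj_transpose (V v) ** X v - conj_transpose (mconv \<kappa> \<tau> V v) ** X v)"
    unfolding mconv_def[of \<kappa> \<tau> X \<tau>]
  proof (rule integral_spike[of "{\<tau>}"])
    fix v assume v: "v \<in> {0..\<tau>} - {\<tau>}"
    have "\<kappa> (\<tau> - v) = conj_transpose (V v - mconv \<kappa> \<tau> V v)"
      using V_eq[of v] v by (simp add: herm')
    then show "conj_transpose (V v) ** X v - conj_transpose (mconv \<kappa> \<tau> V v) ** X v = \<kappa> (\<tau> - v) ** X v"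
      by (simp add: mm.diff_left linear_diff[OF bounded_linear.linear[OF ct]])
  qed auto
  also have "\<dots> = integral {0..\<tau>} (\<lambda>v. conj_transpose (V v) ** X v)
      - integral {0..\<tau>} (\<lambda>v. conj_transpose (mconv \<kappa> \<tau> V v) ** X v)"
    by (intro integral_diff integrable_continuous_real mm.continuous_on V' cV' X)
  also have "integral {0..\<tau>} (\<lambda>v. conj_transpose (mconv \<kappa> \<tau> V v) ** X v) =
      integral {0..\<tau>} (\<lambda>t. conj_transpose (V t) ** mconv \<kappa> \<tau> X t)"
    unfolding conv_swap[OF V' X] conj_conv ..
  also have "integral {0..\<tau>} (\<lambda>v. conj_transpose (V v) ** X v) - \<dots> =
      integral {0..\<tau>} (\<lambda>v. conj_transpose (V v) ** X v - conj_transpose (V v) ** mconv \<kappa> \<tau> X v)"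
    by (intro integral_diff[symmetric] integrable_continuous_real mm.continuous_on V' cX X)
  \<comment> \<open>Now the equation for \<open>X\<close> is used backwards, except at
    \<open>v = 0\<close>, to recover the kernel.\<close>
  also have "\<dots> = integral {0..\<tau>} (\<lambda>v. conj_transpose (V v) ** \<kappa> (v - 0))"
    by (rule integral_spike[of "{0}"]) (auto simp: X_eq mm.diff_right[symmetric])
  also have "\<dots> = conj_transpose (mconv \<kappa> \<tau> V 0)"
    by (simp only: conj_conv)
  finally have "mconv \<kappa> \<tau> X \<tau> = conj_transpose (mconv \<kappa> \<tau> V 0)" .
  moreover have "conj_transpose (V 0) = \<kappa> \<tau> + conj_transpose (mconv \<kappa> \<tau> V 0)"
    using V_eq[of 0] \<tau> herm'[of 0 \<tau>] by (simp add: linear_add[OF bounded_linear.linear[OF ct]])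
  ultimately show ?thesis using X_eq[of \<tau>] \<tau> by simp
qed

text \<open>The new function agrees with \<open>Y \<tau>\<close> on (0,\<tau>], so putting it under
  the integral changes the integrand at most at 0. At 0 itself \<open>h\<close> prescribes the
  value, which replaces an arbitrary value of \<open>Y\<close> by the continuous one.\<close>

lemma (in bounded_kernel) conv_family_extension:
  assumes T: "0 < T" and ap: "\<And>\<tau>. \<tau> \<in> {0<..T} \<Longrightarrow> a_priori_bound \<kappa> \<tau>"
    and h: "continuous_on {0..T} h"
    and Y: "\<And>\<tau>. \<tau> \<in> {0<..T} \<Longrightarrow> Y \<tau> absolutely_integrable_on {0..\<tau>}"
    and Y_eq: "\<And>\<tau> x. \<tau> \<in> {0<..T} \<Longrightarrow> x \<in> {0<..\<tau>} \<Longrightarrow> Y \<tau> x = h x + mconv \<kappa> \<tau> (Y \<tau>) x"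
  shows "conv_family T \<kappa> N h (\<lambda>\<tau> x. h x + mconv \<kappa> \<tau> (Y \<tau>) x)"
proof
  show "0 < T" by fact
  fix \<tau> assume \<tau>: "\<tau> \<in> {0..T}"
  \<comment> \<open>The assumptions say nothing about \<open>Y 0\<close>, but for \<tau> = 0 the
    interval is a null set.\<close>
  have Yi: "Y \<tau> absolutely_integrable_on {0..\<tau>}"
    using Y[of \<tau>] \<tau> by (cases "\<tau> = 0") (auto intro!: absolutely_integrable_negligible)
  show "a_priori_bound \<kappa> \<tau>"
    using ap[of \<tau>] \<tau> by (cases "\<tau> = 0") (auto simp: a_priori_bound_def)
  show "continuous_on {0..T} (\<lambda>x. h x + mconv \<kappa> \<tau> (Y \<tau>) x)"
    using \<tau> by (intro continuous_on_add h continuous_on_conv Yi) auto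
  show "h x + mconv \<kappa> \<tau> (Y \<tau>) x = h x + mconv \<kappa> \<tau> (\<lambda>x. h x + mconv \<kappa> \<tau> (Y \<tau>) x) x" for x
  proof -
    have "mconv \<kappa> \<tau> (Y \<tau>) x = mconv \<kappa> \<tau> (\<lambda>x. h x + mconv \<kappa> \<tau> (Y \<tau>) x) x"
      unfolding mconv_def[of _ _ _ x]
      by (rule integral_spike[of "{0}"]) (use \<tau> in \<open>auto simp: Y_eq[symmetric]\<close>)
    then show ?thesis by simp
  qed
qed

lemma continuous_on_extend_at_right:
  fixes k :: "real \<Rightarrow> 'a::topological_space"
  assumes "continuous_on {0<..T} k" "(k \<longlongrightarrow> l) (at_right 0)"
  shows "continuous_on {0..T} (\<lambda>x. if x = 0 then l else k x)"
  unfolding continuous_on_def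
proof
  fix x assume x: "x \<in> {0..T}"
  show "((\<lambda>x. if x = 0 then l else k x) \<longlongrightarrow> (if x = 0 then l else k x)) (at x within {0..T})"
  proof (cases "x = 0")
    case True
    have "(k \<longlongrightarrow> l) (at 0 within {0..T})"
      by (rule filterlim_mono[OF assms(2) order_refl])
        (auto simp: at_within_def le_inf_iff intro!: inf_le2 le_infI2)
    then have "((\<lambda>x. if x = 0 then l else k x) \<longlongrightarrow> l) (at 0 within {0..T})"
      by (rule Lim_transform_eventually) (auto simp: eventually_at_filter)
    then show ?thesis using True by simp
  next
    case False
    then have x': "x \<in> {0<..T}" using x by auto
    then have "(k \<longlongrightarrow> k x) (at x within {0<..T})" using assms(1) by (auto simp: continuous_on_def)
    moreover have "at x within {0..T} = at x within {0<..T}"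
      by (rule at_within_nhd[of _ "{0<..}"]) (use x' in auto)
    ultimately have "(k \<longlongrightarrow> k x) (at x within {0..T})" by simp
    moreover have "\<forall>\<^sub>F y in at x within {0..T}. y \<noteq> 0"
      using tendsto_imp_eventually_ne[OF tendsto_ident_at False] .
    then have "\<forall>\<^sub>F y in at x within {0..T}. k y = (if y = 0 then l else k y)"
      by (rule eventually_mono) simp
    ultimately show ?thesis using False by (auto intro: Lim_transform_eventually)
  qed
qed

lemma has_vector_derivative_exp_cscale:
  "((\<lambda>\<tau>. cscale (exp (c * of_real \<tau>)) A) has_vector_derivative cscale (c * exp (c * of_real \<tau>)) A) (at \<tau> within S)"
proof (rule bounded_linear.has_vector_derivative[OF bounded_linear_cscale_left])
  have "((\<lambda>w. exp (c * w)) has_field_derivative (c * exp (c * of_real \<tau>))) (at (of_real \<tau>))"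
    by (auto intro!: derivative_eq_intros)
  then show "((\<lambda>\<tau>. exp (c * of_real \<tau>)) has_vector_derivative (c * exp (c * of_real \<tau>))) (at \<tau> within S)"
    by (rule has_vector_derivative_real_field)
qed

section \<open>The canonical differential system\<close>

text \<open>Hermitian symmetry makes the left limit the adjoint of the right limit. At \<tau> = 0
  this is the relation between the two off-diagonal coefficients.\<close>

lemma accelerant_limits:
  assumes "accelerant T k" "0 < T"
  obtains l where "(k \<longlongrightarrow> l) (at_right 0)" "((\<lambda>x. k (- x)) \<longlongrightarrow> conj_transpose l) (at_right 0)"
proof -
  obtain l where l: "(k \<longlongrightarrow> l) (at_right 0)"
    using assms by (auto simp: accelerant_def)
  have "((\<lambda>x. conj_transpose (k x)) \<longlongrightarrow> conj_transpose l) (at_right 0)"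
    by (rule bounded_linear.tendsto[OF bounded_linear_conj_transpose l])
  moreover have "\<forall>\<^sub>F x in at_right 0. conj_transpose (k x) = k (- x)"
    unfolding eventually_at_right_field
    using assms by (intro exI[of _ T]) (auto simp: accelerant_def)
  ultimately have "((\<lambda>x. k (- x)) \<longlongrightarrow> conj_transpose l) (at_right 0)"
    by (rule Lim_transform_eventually)
  with l show ?thesis by (rule that)
qed

text \<open>Dropping the immaterial value at \<open>0\<close> makes the truncation hermitian everywhere.\<close>

definition trunc :: "real \<Rightarrow> (real \<Rightarrow> complex^'r^'r) \<Rightarrow> real \<Rightarrow> complex^'r^'r"
  where "trunc T k x = indicator ({-T..T} - {0}) x *\<^sub>R k x"

lemma trunc_eq: "x \<in> {-T..T} \<Longrightarrow> x \<noteq> 0 \<Longrightarrow> trunc T k x = k x"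
  by (simp add: trunc_def)

lemma trunc_reflect: "trunc T (\<lambda>x. k (- x)) = (\<lambda>x. trunc T k (- x))"
  by (auto simp: trunc_def fun_eq_iff indicator_def)

text \<open>The continuous extensions of the two halves to the compact interval bound
  \<open>k\<close> on either side of the jump. The hypotheses treat the halves symmetrically, so the
  reflected kernel is covered as well.\<close>

lemma bounded_kernel_trunc:
  fixes k :: "real \<Rightarrow> complex^'r^'r"
  assumes pos: "continuous_on {0..T} (\<lambda>x. if x = 0 then l else k x)"
    and neg: "continuous_on {0..T} (\<lambda>x. if x = 0 then l' else k (- x))"
  shows "\<exists>N. bounded_kernel T (trunc T k) N"
proof -
  have cpos: "continuous_on {0<..T} k"
    by (rule continuous_on_eq[OF continuous_on_subset[OF pos]]) auto
  have "continuous_on {0<..T} (\<lambda>x. k (- x))"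
    by (rule continuous_on_eq[OF continuous_on_subset[OF neg]]) auto
  then have "continuous_on {-T..<0} (\<lambda>x. k (- (- x)))"
    by (rule continuous_on_compose2[where f = uminus]) (auto intro: continuous_intros)
  then have cneg: "continuous_on {-T..<0} k" by simp
  have cont: "continuous_on ({-T..<0} \<union> {0<..T}) k"
  proof (rule continuous_on_Un_local_open[OF _ _ cneg cpos])
    show "openin (top_of_set ({-T..<0} \<union> {0<..T})) {-T..<0}"
      unfolding openin_open by (rule exI[of _ "{..<0}"]) auto
    show "openin (top_of_set ({-T..<0} \<union> {0<..T})) {0<..T}"
      unfolding openin_open by (rule exI[of _ "{0<..}"]) auto
  qed
  have eq: "{-T..T} - {0} \<subseteq> {-T..<0} \<union> {0<..T}" by auto
  then have cont': "continuous_on ({-T..T} - {0}) k" by (rule continuous_on_subset[OF cont])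
  have "bounded ((\<lambda>x. if x = 0 then l else k x) ` {0..T})"
    by (intro compact_imp_bounded compact_continuous_image pos) auto
  then obtain M where "\<forall>y\<in>(\<lambda>x. if x = 0 then l else k x) ` {0..T}. norm y \<le> M"
    unfolding bounded_iff by blast
  then have M: "norm (k x) \<le> M" if "x \<in> {0..T}" "x \<noteq> 0" for x
    using that by force
  have "bounded ((\<lambda>x. if x = 0 then l' else k (- x)) ` {0..T})"
    by (intro compact_imp_bounded compact_continuous_image neg) auto
  then obtain M' where "\<forall>y\<in>(\<lambda>x. if x = 0 then l' else k (- x)) ` {0..T}. norm y \<le> M'"
    unfolding bounded_iff by blast
  then have M': "norm (k (- x)) \<le> M'" if "x \<in> {0..T}" "x \<noteq> 0" for x
    using that by force
  \<comment> \<open>The entry 1 makes the kernel constant \<open>B * c\<close> strictly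
    positive.\<close>
  define B where "B = max 1 (max M M')"
  have B: "norm (trunc T k x) \<le> B" for x
    using M[of x] M'[of "- x"]
    by (cases "0 \<le> x") (auto simp: trunc_def B_def indicator_def le_max_iff_disj)
  obtain c where c: "0 < c" "\<And>(A :: complex^'r^'r) (B :: complex^'r^'r). norm (A ** B) \<le> norm A * norm B * c"
    using mm.pos_bounded by blast
  have "bounded_kernel T (trunc T k) (B * c)"
  proof
    show "trunc T k \<in> borel_measurable borel"
      unfolding trunc_def[abs_def] by (rule borel_measurable_continuous_on_indicator[OF _ cont']) auto
    show "norm (trunc T k x ** A) \<le> B * c * norm A" for x and A :: "complex^'r^'r"
    proof -
      have "norm (trunc T k x) * (norm A * c) \<le> B * (norm A * c)"
        using c(1) by (intro mult_right_mono B) auto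
      with c(2)[of "trunc T k x" A] show ?thesis by (simp add: mult_ac)
    qed
    show "bounded (range (trunc T k))" using B by (auto simp: bounded_iff)
    show "continuous_on ({-T..T} - {0}) (trunc T k)"
      by (rule continuous_on_eq[OF cont']) (simp add: trunc_def)
    show "0 < B * c" using c(1) by (simp add: B_def)
  qed
  then show ?thesis ..
qed

lemma mconv_trunc:
  assumes "t \<in> {0..\<tau>}" "\<tau> \<le> T"
  shows "mconv (trunc T k) \<tau> f t = integral {0..\<tau>} (\<lambda>v. k (t - v) ** f v)"
  unfolding mconv_def by (rule integral_spike[of "{t}"]) (use assms in \<open>auto simp: trunc_eq\<close>)

lemma continuous_on_exp_cscale: "continuous_on S (\<lambda>x. cscale (exp (c * of_real x)) A)"
  by (intro bounded_linear.continuous_on[OF bounded_linear_cscale_left] continuous_intros)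

lemma cscale_exp_diff:
  "cscale (exp (\<i> * z * of_real (a - b))) A =
     cscale (exp (\<i> * z * of_real a)) (cscale (exp (- \<i> * z * of_real b)) A)"
  unfolding cscale_cscale exp_add[symmetric] by (simp add: algebra_simps)

theorem theorem1p2:
  fixes T :: real
    and k :: "real \<Rightarrow> complex^'r^'r"
    and \<gamma> :: "real \<Rightarrow> real \<Rightarrow> real \<Rightarrow> complex^'r^'r"
  assumes "T > 0"
    and "accelerant T k"
    and "resolvent_kernel T k \<gamma>"
  shows "\<exists>a :: real \<Rightarrow> complex^'r^'r.
           continuous_on {0..T} a \<and>
           (\<forall>\<tau> \<in> {0<..T}. a \<tau> = \<gamma> \<tau> 0 \<tau>) \<and>
           (\<forall>z :: complex. \<forall>\<tau> \<in> {0..T}.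
              ((\<lambda>\<tau>. krein_Y \<gamma> \<tau> z) has_vector_derivative
                 (krein_Y \<gamma> \<tau> z **
                    (cscale (\<i> * z) (block_mat (mat 1) 0 0 0) +
                     block_mat 0 (a \<tau>) (conj_transpose (a \<tau>)) 0)))
              (at \<tau> within {0..T}))"
proof -

  \<comment> \<open>The truncated kernel, its reflection and the resolvent equations\<close>
  define \<kappa> where "\<kappa> = trunc T k"
  define \<kappa>' where "\<kappa>' = (\<lambda>x. \<kappa> (- x))"
  obtain l where l: "(k \<longlongrightarrow> l) (at_right 0)" "((\<lambda>x. k (- x)) \<longlongrightarrow> conj_transpose l) (at_right 0)"
    by (rule accelerant_limits[OF assms(2,1)])
  define h where "h = (\<lambda>x. if x = 0 then l else k x)"
  define h' where "h' = (\<lambda>x. if x = 0 then conj_transpose l else k (- x))"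
  have h: "continuous_on {0..T} h"
    unfolding h_def using assms(2) by (intro continuous_on_extend_at_right l) (simp add: accelerant_def)
  have "continuous_on {-T..<0} k" using assms(2) by (simp add: accelerant_def)
  then have "continuous_on {0<..T} (\<lambda>x. k (- x))"
    by (rule continuous_on_compose2) (auto intro: continuous_intros)
  then have h': "continuous_on {0..T} h'"
    unfolding h'_def by (rule continuous_on_extend_at_right[OF _ l(2)])
  obtain N where "bounded_kernel T \<kappa> N"
    using bounded_kernel_trunc[OF h[unfolded h_def] h'[unfolded h'_def]] by (auto simp: \<kappa>_def)
  then interpret K: bounded_kernel T \<kappa> N .
  \<comment> \<open>Reflecting \<open>k\<close> exchanges the two one-sided extensions.\<close>
  have "\<exists>N. bounded_kernel T (trunc T (\<lambda>x. k (- x))) N"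
    by (rule bounded_kernel_trunc[OF h'[unfolded h'_def], unfolded minus_minus, OF h[unfolded h_def]])
  then obtain N' where "bounded_kernel T \<kappa>' N'"
    by (auto simp: trunc_reflect \<kappa>'_def \<kappa>_def)
  then interpret K': bounded_kernel T \<kappa>' N' .

  have \<gamma>i: "(\<lambda>v. \<gamma> \<tau> v s) absolutely_integrable_on {0..\<tau>}" if "\<tau> \<in> {0..T}" "s \<in> {0..\<tau>}" for \<tau> s
    using assms(3) that unfolding resolvent_kernel_def
    by (cases "\<tau> = 0") (auto intro!: absolutely_integrable_negligible)
  have \<gamma>_eq: "\<gamma> \<tau> t s = k (t - s) + mconv \<kappa> \<tau> (\<lambda>v. \<gamma> \<tau> v s) t"
    if "\<tau> \<in> {0<..T}" "t \<in> {0..\<tau>}" "s \<in> {0..\<tau>}" for \<tau> t s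
  proof -
    have "\<gamma> \<tau> t s - integral {0..\<tau>} (\<lambda>v. k (t - v) ** \<gamma> \<tau> v s) = k (t - s)"
      using assms(3) that unfolding resolvent_kernel_def by simp
    then show ?thesis
      using that by (simp add: \<kappa>_def mconv_trunc algebra_simps)
  qed
  have \<gamma>_eq': "\<gamma> \<tau> (\<tau> - x) s = k (\<tau> - x - s) + mconv \<kappa>' \<tau> (\<lambda>v. \<gamma> \<tau> (\<tau> - v) s) x"
    if "\<tau> \<in> {0<..T}" "x \<in> {0..\<tau>}" "s \<in> {0..\<tau>}" for \<tau> x s
    using \<gamma>_eq[of \<tau> "\<tau> - x" s] that by (simp add: \<kappa>'_def mconv_reflect)
  have ap: "a_priori_bound \<kappa> \<tau>" if "\<tau> \<in> {0<..T}" for \<tau>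
    by (rule K.a_priori_bound_of_invertible[of _ k])
      (use assms(2) that in \<open>auto simp: accelerant_def \<kappa>_def trunc_eq\<close>)
  have ap': "a_priori_bound \<kappa>' \<tau>" if "\<tau> \<in> {0<..T}" for \<tau>
    unfolding \<kappa>'_def by (rule a_priori_bound_reflect[OF ap[OF that]])
  have herm: "\<kappa> (- x) = conj_transpose (\<kappa> x)" for x
    using assms(2) by (cases "x \<in> {-T..T} - {0}") (auto simp: \<kappa>_def trunc_def accelerant_def)

  \<comment> \<open>The two solution families, for the original and the reflected kernel\<close>
  define X where "X \<tau> x = h x + mconv \<kappa> \<tau> (\<lambda>v. \<gamma> \<tau> v 0) x" for \<tau> x
  define X' where "X' \<tau> x = h' x + mconv \<kappa>' \<tau> (\<lambda>v. \<gamma> \<tau> (\<tau> - v) \<tau>) x" for \<tau> x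
  \<comment> \<open>The point 0 is excluded: there \<open>X\<close> and \<open>X'\<close> carry the
    one-sided limits stored in \<open>h\<close> and \<open>h'\<close>, whereas \<gamma> depends on
    the arbitrary value \<open>k 0\<close>.\<close>
  have X\<gamma>: "X \<tau> x = \<gamma> \<tau> x 0" if "\<tau> \<in> {0<..T}" "x \<in> {0<..\<tau>}" for \<tau> x
    using \<gamma>_eq[of \<tau> x 0] that by (simp add: X_def h_def)
  have X'\<gamma>: "X' \<tau> x = \<gamma> \<tau> (\<tau> - x) \<tau>" if "\<tau> \<in> {0<..T}" "x \<in> {0<..\<tau>}" for \<tau> x
    using \<gamma>_eq'[of \<tau> x \<tau>] that by (simp add: X'_def h'_def)
  interpret F: conv_family T \<kappa> N h X
    unfolding X_def[abs_def]
  proof (rule K.conv_family_extension[OF assms(1) ap h])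
    fix \<tau> x assume "\<tau> \<in> {0<..T}" "x \<in> {0<..\<tau>}"
    then show "\<gamma> \<tau> x 0 = h x + mconv \<kappa> \<tau> (\<lambda>v. \<gamma> \<tau> v 0) x"
      using X\<gamma> by (simp add: X_def)
  qed (auto intro: \<gamma>i)
  interpret F': conv_family T \<kappa>' N' h' X'
    unfolding X'_def[abs_def]
  proof (rule K'.conv_family_extension[OF assms(1) ap' h'])
    fix \<tau> x assume "\<tau> \<in> {0<..T}" "x \<in> {0<..\<tau>}"
    then show "\<gamma> \<tau> (\<tau> - x) \<tau> = h' x + mconv \<kappa>' \<tau> (\<lambda>v. \<gamma> \<tau> (\<tau> - v) \<tau>) x"
      using X'\<gamma> by (simp add: X'_def)
  qed (auto intro!: \<gamma>i absolutely_integrable_reflect_Icc)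

  \<comment> \<open>The adjoint relation on the diagonal\<close>
  have adj: "conj_transpose (X' \<tau> \<tau>) = X \<tau> \<tau>" if \<tau>: "\<tau> \<in> {0..T}" for \<tau>
  proof (cases "\<tau> = 0")
    case True
    then show ?thesis by (simp add: X_def X'_def h_def h'_def mconv_def)
  next
    case False
    then have \<tau>': "0 < \<tau>" "\<tau> \<le> T" using \<tau> by auto
    \<comment> \<open>Writing \<tau> as \<open>\<tau> - 0\<close> presents the left side as the
      value at 0 of the reflected function \<open>V\<close>.\<close>
    have "conj_transpose (X' \<tau> (\<tau> - 0)) = X \<tau> \<tau>"
    proof (rule K.resolvent_adjoint[OF herm \<tau>', where X = "X \<tau>" and V = "\<lambda>t. X' \<tau> (\<tau> - t)"])
      show "continuous_on {0..\<tau>} (X \<tau>)"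
        by (rule continuous_on_subset[OF F.X_cont[OF \<tau>]]) (use \<tau> in auto)
      show "continuous_on {0..\<tau>} (\<lambda>t. X' \<tau> (\<tau> - t))"
        by (rule continuous_on_compose2[OF F'.X_cont[OF \<tau>]]) (use \<tau> in \<open>auto intro: continuous_intros\<close>)
      show "X \<tau> t = \<kappa> t + mconv \<kappa> \<tau> (X \<tau>) t" if "t \<in> {0<..\<tau>}" for t
        using F.X_eq[OF \<tau>, of t] that \<tau>' by (simp add: h_def \<kappa>_def trunc_eq)
      show "X' \<tau> (\<tau> - t) = \<kappa> (t - \<tau>) + mconv \<kappa> \<tau> (\<lambda>t. X' \<tau> (\<tau> - t)) t" if "t \<in> {0..<\<tau>}" for t
        using F'.X_eq[OF \<tau>, of "\<tau> - t"] that \<tau>'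
        by (simp add: h'_def \<kappa>_def trunc_eq \<kappa>'_def mconv_reflect)
    qed
    then show ?thesis by simp
  qed

  have P_eq: "krein_P \<gamma> \<tau> z = cscale (exp (\<i> * z * of_real \<tau>)) (mat 1) **
      (mat 1 + integral {0..\<tau>} (\<lambda>x. cscale (exp (- \<i> * z * of_real x)) (mat 1) ** X \<tau> x))"
    if "\<tau> \<in> {0..T}" for \<tau> z
  proof -
    have "integral {0..\<tau>} (\<lambda>x. cscale (exp (- \<i> * z * of_real x)) (\<gamma> \<tau> x 0)) =
        integral {0..\<tau>} (\<lambda>x. cscale (exp (- \<i> * z * of_real x)) (mat 1) ** X \<tau> x)"
      by (rule integral_spike[of "{0}"]) (use that in \<open>auto simp: X\<gamma> cscale_eq_mult[symmetric]\<close>)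
    then show ?thesis unfolding krein_P_def by (simp add: cscale_eq_mult[symmetric])
  qed
  have Ps_eq: "krein_P_star \<gamma> \<tau> z =
      mat 1 + integral {0..\<tau>} (\<lambda>x. cscale (exp (\<i> * z * of_real x)) (mat 1) ** X' \<tau> x)"
    if "\<tau> \<in> {0..T}" for \<tau> z
  proof -
    have "integral {0..\<tau>} (\<lambda>x. cscale (exp (\<i> * z * of_real x)) (\<gamma> \<tau> (\<tau> - x) \<tau>)) =
        integral {0..\<tau>} (\<lambda>x. cscale (exp (\<i> * z * of_real x)) (mat 1) ** X' \<tau> x)"
      by (rule integral_spike[of "{0}"]) (use that in \<open>auto simp: X'\<gamma> cscale_eq_mult[symmetric]\<close>)
    then show ?thesis unfolding krein_P_star_def by simp
  qed

  \<comment> \<open>The derivatives of the two Krein functions\<close>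
  have Ps_deriv: "((\<lambda>\<tau>. krein_P_star \<gamma> \<tau> z) has_vector_derivative krein_P \<gamma> \<tau> z ** X' \<tau> \<tau>)
      (at \<tau> within {0..T})" if \<tau>: "\<tau> \<in> {0..T}" for \<tau> z
  proof (rule has_vector_derivative_transform[OF \<tau> Ps_eq])
    let ?\<phi> = "\<lambda>x::real. cscale (exp (\<i> * z * of_real x)) (mat 1) :: complex^'r^'r"
    have \<gamma>i0: "(\<lambda>x. \<gamma> \<tau> x 0) absolutely_integrable_on {0..\<tau>}" using \<gamma>i \<tau> by auto
    \<comment> \<open>For the reflected kernel the function \<open>W\<close> is the reflection of
      the resolvent column at 0, by \<open>\<gamma>_eq'\<close> with \<open>s = 0\<close>.\<close>
    have "((\<lambda>\<sigma>. integral {0..\<sigma>} (\<lambda>x. ?\<phi> x ** X' \<sigma> x)) has_vector_derivative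
        (?\<phi> \<tau> + integral {0..\<tau>} (\<lambda>x. ?\<phi> x ** \<gamma> \<tau> (\<tau> - x) 0)) ** X' \<tau> \<tau>) (at \<tau> within {0..T})"
    proof (rule F'.has_vector_derivative_integral_X[OF \<tau> absolutely_integrable_reflect_Icc[OF \<gamma>i0]])
      show "\<gamma> \<tau> (\<tau> - x) 0 = \<kappa>' (x - \<tau>) + mconv \<kappa>' \<tau> (\<lambda>x. \<gamma> \<tau> (\<tau> - x) 0) x" if "x \<in> {0..<\<tau>}" for x
        using \<gamma>_eq'[of \<tau> x 0] that \<tau> by (simp add: \<kappa>'_def \<kappa>_def trunc_eq)
    qed (rule continuous_on_exp_cscale)
    moreover have "?\<phi> \<tau> + integral {0..\<tau>} (\<lambda>x. ?\<phi> x ** \<gamma> \<tau> (\<tau> - x) 0) = krein_P \<gamma> \<tau> z"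
    proof -
      \<comment> \<open>Reflection moves \<tau> - x into the exponential, whose factor at \<tau> can
        then be taken out; what remains is the bracket in \<open>krein_P\<close>.\<close>
      have "integral {0..\<tau>} (\<lambda>x. ?\<phi> x ** \<gamma> \<tau> (\<tau> - x) 0) = integral {0..\<tau>} (\<lambda>x. ?\<phi> (\<tau> - x) ** \<gamma> \<tau> x 0)"
        using integral_reflect_Icc[of \<tau> "\<lambda>x. ?\<phi> (\<tau> - x) ** \<gamma> \<tau> x 0"] by simp
      also have "\<dots> = integral {0..\<tau>} (\<lambda>x. ?\<phi> \<tau> ** cscale (exp (- \<i> * z * of_real x)) (\<gamma> \<tau> x 0))"
        by (intro integral_cong) (simp only: cscale_eq_mult[symmetric] cscale_exp_diff[symmetric])
      also have "\<dots> = ?\<phi> \<tau> ** integral {0..\<tau>} (\<lambda>x. cscale (exp (- \<i> * z * of_real x)) (\<gamma> \<tau> x 0))"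
      proof -
        have "(\<lambda>x. cscale (exp (- \<i> * z * of_real x)) (mat 1) ** \<gamma> \<tau> x 0) absolutely_integrable_on {0..\<tau>}"
          by (rule continuous_mult_integrable[OF continuous_on_exp_cscale order_refl \<gamma>i0])
        then have "(\<lambda>x. cscale (exp (- \<i> * z * of_real x)) (\<gamma> \<tau> x 0)) integrable_on {0..\<tau>}"
          by (simp add: absolutely_integrable_on_def cscale_eq_mult[symmetric])
        from integral_linear[OF this mm.bounded_linear_right[of "?\<phi> \<tau>"]] show ?thesis by (simp add: o_def)
      qed
      finally show ?thesis
        unfolding krein_P_def by (subst (3) cscale_eq_mult) (simp add: mm.add_right)
    qed
    ultimately show "((\<lambda>\<tau>. mat 1 + integral {0..\<tau>} (\<lambda>x. ?\<phi> x ** X' \<tau> x)) has_vector_derivative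
        krein_P \<gamma> \<tau> z ** X' \<tau> \<tau>) (at \<tau> within {0..T})"
      by (auto intro!: derivative_eq_intros)
  qed

  have P_deriv: "((\<lambda>\<tau>. krein_P \<gamma> \<tau> z) has_vector_derivative
      cscale (\<i> * z) (krein_P \<gamma> \<tau> z) + krein_P_star \<gamma> \<tau> z ** X \<tau> \<tau>)
      (at \<tau> within {0..T})" if \<tau>: "\<tau> \<in> {0..T}" for \<tau> z
  proof (rule has_vector_derivative_transform[OF \<tau> P_eq])
    let ?e = "\<lambda>x::real. cscale (exp (\<i> * z * of_real x)) (mat 1) :: complex^'r^'r"
    let ?\<phi> = "\<lambda>x::real. cscale (exp (- \<i> * z * of_real x)) (mat 1) :: complex^'r^'r"
    have \<gamma>i\<tau>: "(\<lambda>x. \<gamma> \<tau> x \<tau>) absolutely_integrable_on {0..\<tau>}" using \<gamma>i \<tau> by auto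
    have "((\<lambda>\<sigma>. integral {0..\<sigma>} (\<lambda>x. ?\<phi> x ** X \<sigma> x)) has_vector_derivative
        (?\<phi> \<tau> + integral {0..\<tau>} (\<lambda>x. ?\<phi> x ** \<gamma> \<tau> x \<tau>)) ** X \<tau> \<tau>) (at \<tau> within {0..T})"
    proof (rule F.has_vector_derivative_integral_X[OF \<tau> \<gamma>i\<tau>])
      show "\<gamma> \<tau> x \<tau> = \<kappa> (x - \<tau>) + mconv \<kappa> \<tau> (\<lambda>x. \<gamma> \<tau> x \<tau>) x" if "x \<in> {0..<\<tau>}" for x
        using \<gamma>_eq[of \<tau> x \<tau>] that \<tau> by (simp add: \<kappa>_def trunc_eq)
    qed (rule continuous_on_exp_cscale)
    then have d: "((\<lambda>\<sigma>. mat 1 + integral {0..\<sigma>} (\<lambda>x. ?\<phi> x ** X \<sigma> x)) has_vector_derivative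
        (?\<phi> \<tau> + integral {0..\<tau>} (\<lambda>x. ?\<phi> x ** \<gamma> \<tau> x \<tau>)) ** X \<tau> \<tau>) (at \<tau> within {0..T})"
      by (auto intro!: derivative_eq_intros)
    \<comment> \<open>Multiplication by the exponential at \<tau> turns the weight at
      \<open>x\<close> into the one at \<tau> - x; reflecting the integral gives the definition of
      \<open>krein_P_star\<close>.\<close>
    have star: "?e \<tau> ** (?\<phi> \<tau> + integral {0..\<tau>} (\<lambda>x. ?\<phi> x ** \<gamma> \<tau> x \<tau>)) = krein_P_star \<gamma> \<tau> z"
    proof -
      have "(\<lambda>x. ?\<phi> x ** \<gamma> \<tau> x \<tau>) integrable_on {0..\<tau>}"
        using continuous_mult_integrable[OF continuous_on_exp_cscale[of _ "- \<i> * z"] order_refl \<gamma>i\<tau>]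
        unfolding absolutely_integrable_on_def by blast
      from integral_linear[OF this mm.bounded_linear_right[of "?e \<tau>"]]
      have "?e \<tau> ** integral {0..\<tau>} (\<lambda>x. ?\<phi> x ** \<gamma> \<tau> x \<tau>) =
          integral {0..\<tau>} (\<lambda>x. ?e \<tau> ** (?\<phi> x ** \<gamma> \<tau> x \<tau>))"
        by (simp add: o_def)
      also have "\<dots> = integral {0..\<tau>} (\<lambda>x. cscale (exp (\<i> * z * of_real (\<tau> - x))) (\<gamma> \<tau> (\<tau> - (\<tau> - x)) \<tau>))"
        by (intro integral_cong) (simp only: cscale_eq_mult[symmetric] cscale_exp_diff[symmetric] diff_diff_eq2 add_diff_cancel_left')
      also have "\<dots> = integral {0..\<tau>} (\<lambda>x. cscale (exp (\<i> * z * of_real x)) (\<gamma> \<tau> (\<tau> - x) \<tau>))"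
        by (rule integral_reflect_Icc)
      moreover have "?e \<tau> ** ?\<phi> \<tau> = mat 1"
        using cscale_exp_diff[of z \<tau> \<tau> "mat 1 :: complex^'r^'r"] by (simp only: cscale_eq_mult[symmetric]) simp
      ultimately show ?thesis
        by (simp only: krein_P_star_def mm.add_right)
    qed
    \<comment> \<open>In the product rule the second summand, from the exponential, is
      \<open>\<i> * z\<close> times \<open>krein_P\<close>, and the first, from the bracket, is
      \<open>krein_P_star\<close> times \<open>X \<tau> \<tau>\<close>.\<close>
    have "((\<lambda>\<tau>. ?e \<tau> ** (mat 1 + integral {0..\<tau>} (\<lambda>x. ?\<phi> x ** X \<tau> x))) has_vector_derivative
        ?e \<tau> ** ((?\<phi> \<tau> + integral {0..\<tau>} (\<lambda>x. ?\<phi> x ** \<gamma> \<tau> x \<tau>)) ** X \<tau> \<tau>)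
        + cscale (\<i> * z * exp (\<i> * z * of_real \<tau>)) (mat 1) ** (mat 1 + integral {0..\<tau>} (\<lambda>x. ?\<phi> x ** X \<tau> x)))
        (at \<tau> within {0..T})"
      by (rule mm.has_vector_derivative[OF has_vector_derivative_exp_cscale d])
    moreover have "cscale (\<i> * z * exp (\<i> * z * of_real \<tau>)) (mat 1) **
        (mat 1 + integral {0..\<tau>} (\<lambda>x. ?\<phi> x ** X \<tau> x)) = cscale (\<i> * z) (krein_P \<gamma> \<tau> z)"
      unfolding P_eq[OF \<tau>] cscale_cscale[symmetric] cscale_mult_left ..
    ultimately show "((\<lambda>\<tau>. ?e \<tau> ** (mat 1 + integral {0..\<tau>} (\<lambda>x. ?\<phi> x ** X \<tau> x))) has_vector_derivative
        cscale (\<i> * z) (krein_P \<gamma> \<tau> z) + krein_P_star \<gamma> \<tau> z ** X \<tau> \<tau>) (at \<tau> within {0..T})"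
      by (simp only: matrix_mul_assoc star add.commute[of _ "krein_P_star \<gamma> \<tau> z ** X \<tau> \<tau>"])
  qed

  show ?thesis
  \<comment> \<open>The diagonal of the reflected family is continuous up to 0, where its value is
    \<open>conj_transpose l\<close>; for positive \<tau> it is the resolvent kernel at
    (0,\<tau>).\<close>
  proof (intro exI[of _ "\<lambda>\<tau>. X' \<tau> \<tau>"] conjI ballI allI)
    show "continuous_on {0..T} (\<lambda>\<tau>. X' \<tau> \<tau>)" by (rule F'.continuous_on_X_diagonal)
    show "X' \<tau> \<tau> = \<gamma> \<tau> 0 \<tau>" if "\<tau> \<in> {0<..T}" for \<tau>
      using X'\<gamma>[of \<tau> \<tau>] that by simp
    fix z :: complex and \<tau> assume \<tau>: "\<tau> \<in> {0..T}"
    let ?P = "krein_P \<gamma> \<tau> z" and ?Q = "krein_P_star \<gamma> \<tau> z"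
    \<comment> \<open>By \<open>adj\<close> the lower left block is \<open>X \<tau> \<tau>\<close>,
      so the two block columns of the product are exactly the two derivatives found above.\<close>
    have "krein_Y \<gamma> \<tau> z ** (cscale (\<i> * z) (block_mat (mat 1) 0 0 0) +
          block_mat 0 (X' \<tau> \<tau>) (conj_transpose (X' \<tau> \<tau>)) 0)
        = block_row (cscale (\<i> * z) ?P + ?Q ** X \<tau> \<tau>) 0 + block_row 0 (?P ** X' \<tau> \<tau>)"
    proof -
      have c0: "cscale c 0 = (0 :: complex^'r^'r)" for c
        by (simp add: cscale_def map_matrix_def vec_eq_iff)
      show ?thesis
        unfolding krein_Y_def adj[OF \<tau>] cscale_block_mat block_mat_add block_row_mult_block_mat
        by (subst block_row_add) (simp add: c0 cscale_mult_right)
    qed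
    moreover have "((\<lambda>\<tau>. block_row (krein_P \<gamma> \<tau> z) 0 + block_row 0 (krein_P_star \<gamma> \<tau> z)) has_vector_derivative
        block_row (cscale (\<i> * z) ?P + ?Q ** X \<tau> \<tau>) 0 + block_row 0 (?P ** X' \<tau> \<tau>)) (at \<tau> within {0..T})"
      by (intro has_vector_derivative_add
          bounded_linear.has_vector_derivative[OF bounded_linear_block_row_left P_deriv[OF \<tau>]]
          bounded_linear.has_vector_derivative[OF bounded_linear_block_row_right Ps_deriv[OF \<tau>]])
    ultimately show "((\<lambda>\<tau>. krein_Y \<gamma> \<tau> z) has_vector_derivative krein_Y \<gamma> \<tau> z **
        (cscale (\<i> * z) (block_mat (mat 1) 0 0 0) + block_mat 0 (X' \<tau> \<tau>) (conj_transpose (X' \<tau> \<tau>)) 0))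
        (at \<tau> within {0..T})"
      unfolding krein_Y_def block_row_add[of "krein_P _ _ _" "krein_P_star _ _ _"] by simp
  qed
qed

end
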